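(* Suppose that $f_\gamma(0)=0$ for every $\gamma\in\Gamma$ such that $0\in\chi_\gamma$, and that for every $\gamma\in\Gamma$ such that $0\in\chi_\gamma$ the initial value problem $\dot x=f_\gamma(x)$, $x(0)=0$ has a unique solution. Let $(x,\sigma)$ be a forward complete trajectory of $\dot x=f(x,\sigma)$ with $\sigma\in\mathcal{S}_a$. For $V\in\mathcal{V}$ and a family $\{W_\gamma:\mathcal{O}_\gamma\to\mathbb{R},\gamma\in\Gamma\}$ consider the conditions $(\ast)$ $-\nabla V_\gamma(\xi)f_\gamma(\xi)\ge W_\gamma(\xi)\ge0$ for all $\xi\in\mathcal{O}_\gamma$ and all $\gamma\in\Gamma$; (i) $\mathcal{O}_\gamma^f(f_\gamma,W_\gamma,\infty)\cap\mathcal{O}_\gamma^b(f_\gamma,W_\gamma,\infty)\subset\{0\}$ for every $\gamma\in\Gamma$; (ii) $\mathcal{O}_\gamma^b(f_\gamma,W_\gamma)\cap\mathcal{O}_{\gamma'}^f(f_{\gamma'},W_{\gamma'})\subset\{0\}$ for all $\gamma\ne\gamma'$ in $\Gamma$; (ii') $\mathcal{O}_\gamma^b(f_\gamma,W_\gamma)\cap\mathcal{O}_{\gamma'}^f(f_{\gamma'},W_{\gamma'})\cap V_\gamma^{-1}(c)\cap V_{\gamma'}^{-1}(c)\subset\{0\}$ for all $\gamma\ne\gamma'$ in $\Gamma$ and all $c\in\mathbb{R}$. 1. Suppose there exist $V\in\mathcal{V}$, bounded on compact subsets of $\mathrm{dom}(f)\cap(\mathcal{O}\times\Gamma)$, and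 a family $\{W_\gamma:\mathcal{O}_\gamma\to\mathbb{R},\gamma\in\Gamma\}$ such that $(x,\sigma)$ is precompact relative to $\mathcal{O}$, $v(t)=V(x(t),\sigma(t))$ is nonincreasing on $[0,+\infty)$, $(\ast)$ holds and $W(\xi,\gamma):=W_\gamma(\xi)$ is continuous on $\mathrm{dom}(f)\cap(\mathcal{O}\times\Gamma)$; suppose also that $0\in\mathcal{O}$ and that (i) and (ii) hold. Then $x\to0$. If $\Gamma$ is finite, the same conclusion holds if instead there exist $V\in\mathcal{V}$ and a family $\{W_\gamma:\mathcal{O}_\gamma\to\mathbb{R},\gamma\in\Gamma\}$ such that $(x,\sigma)$ is precompact relative to $\mathcal{O}$, for every $\gamma\in\Gamma$ the function $v(t)=V(x(t),\sigma(t))$ is nonincreasing on $\sigma^{-1}(\gamma)\cap[0,+\infty)$, $(\ast)$ holds, $0\in\mathcal{O}$, and (i) and (ii) hold. 2. Suppose there exist $V\in\mathcal{V}$, whose restriction to $\mathrm{dom}(f)\cap(\mathcal{O}\times\Gamma)$ is continuous, and a family $\{W_\gamma:\mathcal{O}_\gamma\to\mathbb{R},\gamma\in\Gamma\}$ such that $(x,\sigma)$ is precompact relative to $\mathcal{O}$, $v(t)=V(x(t),\sigma(t))$ is nonincreasing on $[0,+\infty)$ and $(\ast)$ holds; suppose also that $0\in\mathcal{O}$ and that (i) and (ii') hold. Then $x\to0$.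
   Context: Setting: $\Gamma$ is a compact metric space, $\mathrm{dom}(f)\subset\mathbb{R}^n\times\Gamma$ is closed and $f:\mathrm{dom}(f)\to\mathbb{R}^n$ is continuous. For $\gamma\in\Gamma$, $\chi_\gamma=\{\xi\in\mathbb{R}^n:(\xi,\gamma)\in\mathrm{dom}(f)\}$ and $f_\gamma:\chi_\gamma\to\mathbb{R}^n$, $f_\gamma(\xi)=f(\xi,\gamma)$. A switching signal is a function $\sigma:\mathbb{R}\to\Gamma$ that is piecewise constant (at most finitely many jumps in each compact interval) and continuous from the right; $\Lambda(\sigma)$ is the set of times at which $\sigma$ has a jump. A solution of $\dot x=f(x,\sigma)$ corresponding to $\sigma$ is a locally absolutely continuous $x:I_x\to\mathbb{R}^n$, $I_x\subset\mathbb{R}$ a nonempty interval, with $(x(t),\sigma(t))\in\mathrm{dom}(f)$ for all $t\in I_x$ and $\dot x(t)=f(x(t),\sigma(t))$ for almost all $t\in I_x$. Then $(x,\sigma)$ is called a trajectory; it is forward complete if $\mathbb{R}_{\ge0}\subset I_x$. It is precompact relative to $\mathcal{O}\subset\mathbb{R}^n$ if there is a compact set $B\subset\mathcal{O}$ with $x(t)\in B$ for all $t\in I_x$. Uniqueness for $\dot x=f_\gamma(x)$, $x(0)=0$ means that any solution on an interval containing $0$ (forward and backward in time) coincides with the zero solution there. $\mathcal{S}_a=\bigcup_{\tau_D>0,N_0\in\mathbb{N}}\mathcal{S}_a[\tau_D,N_0]$, where $\mathcal{S}_a[\tau_D,N_0]$ is the set of switching signals $\sigma$ with $\mathrm{card}(\Lambda(\sigma)\cap(\tau_1,\tau_2))\le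 N_0+(\tau_2-\tau_1)/\tau_D$ for every finite open interval $(\tau_1,\tau_2)$. $x\to0$ means $\lim_{t\to+\infty}x(t)=0$. $\pi_1:\mathbb{R}^n\times\Gamma\to\mathbb{R}^n$ is the projection onto the first component. Class $\mathcal{V}$: $V:\mathrm{dom}(V)\to\mathbb{R}$ belongs to $\mathcal{V}$ if $\mathrm{dom}(V)\subset\mathbb{R}^n\times\Gamma$; for every $\gamma\in\Gamma$ the set $\mathcal{D}_\gamma=\{\xi:(\xi,\gamma)\in\mathrm{dom}(V)\}$ is open; with $\mathcal{O}=\pi_1(\mathrm{dom}(V))$ and $\mathcal{O}_\gamma=\mathcal{O}\cap\chi_\gamma$, one has $\mathcal{O}_\gamma\subset\mathcal{D}_\gamma$ for all $\gamma$; and for all $\gamma$, $V_\gamma(\cdot)=V(\cdot,\gamma)$ is differentiable on $\mathcal{O}_\gamma$. ($\mathcal{O}$ and $\mathcal{O}_\gamma$ always refer to the function $V$ under consideration.) Observability-like sets: given $\mathcal{X}\subset\mathbb{R}^n$, a continuous map $g:\mathcal{X}\to\mathbb{R}^n$, a function $h:\mathcal{X}\to\mathbb{R}$ and $\tau>0$ or $\tau=\infty$, $\mathcal{X}^f(g,h,\tau)$ (resp. $\mathcal{X}^b(g,h,\tau)$) is the set of $\xi\in\mathcal{X}$ for which there is a solution $\varphi:[0,\tau]\to\mathcal{X}$ (resp. $\varphi:[-\tau,0]\to\mathcal{X}$) of $\dot x=g(x)$ with $\varphi(0)=\xi$ and $h(\varphi(t))=0$ for all $t\in[0,\tau]$ (resp.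 $t\in[-\tau,0]$); for $\tau=\infty$ the intervals are $[0,\infty)$ and $(-\infty,0]$. Also $\mathcal{X}^f(g,h)=\bigcup_{\tau>0}\mathcal{X}^f(g,h,\tau)$ and $\mathcal{X}^b(g,h)=\bigcup_{\tau>0}\mathcal{X}^b(g,h,\tau)$. The sets $\mathcal{O}_\gamma^f(f_\gamma,W_\gamma)$, $\mathcal{O}_\gamma^b(f_\gamma,W_\gamma)$, $\mathcal{O}_\gamma^f(f_\gamma,W_\gamma,\infty)$, $\mathcal{O}_\gamma^b(f_\gamma,W_\gamma,\infty)$ are these sets with $\mathcal{X}=\mathcal{O}_\gamma$, $g=f_\gamma|_{\mathcal{O}_\gamma}$, $h=W_\gamma$. *)

theory Defs
  imports "HOL-Analysis.Analysis"
begin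

text \<open>
  A partially defined map on a subset of the product of the state space and the index set is
  given by its domain together with a total function whose values off the domain play no role.
  The index set is a compact subset of a metric space, with the induced metric.
\<close>

definition fiber :: "('a \<times> 'g) set \<Rightarrow> 'g \<Rightarrow> 'a set" where
  "fiber D \<gamma> = {\<xi>. (\<xi>, \<gamma>) \<in> D}"


subsection \<open>Locally absolutely continuous functions and solutions\<close>

text \<open>The members of a division have pairwise disjoint interiors. Degenerate members contribute
  zero to both sums.\<close>

definition abs_continuous_on :: "real \<Rightarrow> real \<Rightarrow> (real \<Rightarrow> 'a::real_normed_vector) \<Rightarrow> bool" where
  "abs_continuous_on a b x \<longleftrightarrow>
     (\<forall>\<epsilon>>0. \<exists>\<delta>>0. \<forall>d t. d division_of t \<and> t \<subseteq> {a..b} \<and> (\<Sum>k\<in>d. Sup k - Inf k) < \<delta> \<longrightarrow>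
        (\<Sum>k\<in>d. norm (x (Sup k) - x (Inf k))) < \<epsilon>)"

definition loc_abs_continuous_on :: "real set \<Rightarrow> (real \<Rightarrow> 'a::real_normed_vector) \<Rightarrow> bool" where
  "loc_abs_continuous_on J x \<longleftrightarrow> (\<forall>a b. {a..b} \<subseteq> J \<longrightarrow> abs_continuous_on a b x)"

text \<open>The equation \<open>x' = G t x\<close> on the interval \<open>J\<close>, where \<open>G t\<close> has domain \<open>X t\<close>.\<close>

definition is_solution ::
  "(real \<Rightarrow> 'a set) \<Rightarrow> (real \<Rightarrow> 'a \<Rightarrow> 'a) \<Rightarrow> real set \<Rightarrow> (real \<Rightarrow> 'a::euclidean_space) \<Rightarrow> bool" where
  "is_solution X G J x \<longleftrightarrow>
     is_interval J \<and> J \<noteq> {} \<and> loc_abs_continuous_on J x \<and> (\<forall>t\<in>J. x t \<in> X t) \<and>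
     (AE t in lebesgue. t \<in> J \<longrightarrow> (x has_vector_derivative G t (x t)) (at t within J))"

abbreviation is_autonomous_solution ::
  "'a set \<Rightarrow> ('a \<Rightarrow> 'a) \<Rightarrow> real set \<Rightarrow> (real \<Rightarrow> 'a::euclidean_space) \<Rightarrow> bool" where
  "is_autonomous_solution X g \<equiv> is_solution (\<lambda>t. X) (\<lambda>t. g)"

definition unique_zero_solution :: "'a set \<Rightarrow> ('a \<Rightarrow> 'a::euclidean_space) \<Rightarrow> bool" where
  "unique_zero_solution X g \<longleftrightarrow>
     (\<forall>J x. is_autonomous_solution X g J x \<and> 0 \<in> J \<and> x 0 = 0 \<longrightarrow> (\<forall>t\<in>J. x t = 0))"


subsection \<open>Switching signals and trajectories\<close>

definition jumps :: "(real \<Rightarrow> 'g::topological_space) \<Rightarrow> real set" where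
  "jumps \<sigma> = {t. \<not> isCont \<sigma> t}"

text \<open>Constancy between jumps is required separately: when the index set is not totally
  disconnected, continuity there does not imply it.\<close>

definition switching_signal :: "'g::metric_space set \<Rightarrow> (real \<Rightarrow> 'g) \<Rightarrow> bool" where
  "switching_signal \<Gamma> \<sigma> \<longleftrightarrow>
     range \<sigma> \<subseteq> \<Gamma> \<and>
     (\<forall>a b. finite (jumps \<sigma> \<inter> {a..b})) \<and>
     (\<forall>a b. jumps \<sigma> \<inter> {a<..<b} = {} \<longrightarrow> \<sigma> constant_on {a<..<b}) \<and>
     (\<forall>t. continuous (at_right t) \<sigma>)"

definition avg_dwell :: "'g::metric_space set \<Rightarrow> real \<Rightarrow> nat \<Rightarrow> (real \<Rightarrow> 'g) set" where
  "avg_dwell \<Gamma> \<tau>\<^sub>D N\<^sub>0 =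
     {\<sigma>. switching_signal \<Gamma> \<sigma> \<and>
        (\<forall>a b. a < b \<longrightarrow> real (card (jumps \<sigma> \<inter> {a<..<b})) \<le> real N\<^sub>0 + (b - a) / \<tau>\<^sub>D)}"

definition avg_dwell_signals :: "'g::metric_space set \<Rightarrow> (real \<Rightarrow> 'g) set" where
  "avg_dwell_signals \<Gamma> = (\<Union>\<tau>\<^sub>D\<in>{0<..}. \<Union>N\<^sub>0. avg_dwell \<Gamma> \<tau>\<^sub>D N\<^sub>0)"

definition trajectory ::
  "'g::metric_space set \<Rightarrow> ('a::euclidean_space \<times> 'g) set \<Rightarrow> ('a \<times> 'g \<Rightarrow> 'a) \<Rightarrow>
   real set \<Rightarrow> (real \<Rightarrow> 'a) \<Rightarrow> (real \<Rightarrow> 'g) \<Rightarrow> bool" where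
  "trajectory \<Gamma> domf f J x \<sigma> \<longleftrightarrow>
     switching_signal \<Gamma> \<sigma> \<and>
     is_solution (\<lambda>t. fiber domf (\<sigma> t)) (\<lambda>t \<xi>. f (\<xi>, \<sigma> t)) J x"

definition precompact_rel :: "'a::topological_space set \<Rightarrow> real set \<Rightarrow> (real \<Rightarrow> 'a) \<Rightarrow> bool" where
  "precompact_rel U J x \<longleftrightarrow> (\<exists>B. compact B \<and> B \<subseteq> U \<and> (\<forall>t\<in>J. x t \<in> B))"


subsection \<open>Functions of class V\<close>

text \<open>In the sequel \<open>fst ` domV\<close> is the projection of the domain of \<open>V\<close> to the state space.\<close>

definition sect :: "('a \<times> 'g) set \<Rightarrow> ('a \<times> 'g) set \<Rightarrow> 'g \<Rightarrow> 'a set" where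
  "sect domf domV \<gamma> = fst ` domV \<inter> fiber domf \<gamma>"

definition class_V ::
  "'g set \<Rightarrow> ('a::euclidean_space \<times> 'g) set \<Rightarrow> ('a \<times> 'g) set \<Rightarrow> ('a \<times> 'g \<Rightarrow> real) \<Rightarrow> bool" where
  "class_V \<Gamma> domf domV V \<longleftrightarrow>
     domV \<subseteq> UNIV \<times> \<Gamma> \<and>
     (\<forall>\<gamma>\<in>\<Gamma>. open (fiber domV \<gamma>) \<and> sect domf domV \<gamma> \<subseteq> fiber domV \<gamma> \<and>
        (\<forall>\<xi>\<in>sect domf domV \<gamma>. (\<lambda>\<zeta>. V (\<zeta>, \<gamma>)) differentiable (at \<xi>)))"

definition grad :: "('a::euclidean_space \<Rightarrow> real) \<Rightarrow> 'a \<Rightarrow> 'a" where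
  "grad F \<xi> = (THE D. GDERIV F \<xi> :> D)"

definition decrease_cond ::
  "'g set \<Rightarrow> ('a::euclidean_space \<times> 'g) set \<Rightarrow> ('a \<times> 'g \<Rightarrow> 'a) \<Rightarrow>
   ('a \<times> 'g) set \<Rightarrow> ('a \<times> 'g \<Rightarrow> real) \<Rightarrow> ('g \<Rightarrow> 'a \<Rightarrow> real) \<Rightarrow> bool" where
  "decrease_cond \<Gamma> domf f domV V W \<longleftrightarrow>
     (\<forall>\<gamma>\<in>\<Gamma>. \<forall>\<xi>\<in>sect domf domV \<gamma>.
        - (grad (\<lambda>\<zeta>. V (\<zeta>, \<gamma>)) \<xi> \<bullet> f (\<xi>, \<gamma>)) \<ge> W \<gamma> \<xi> \<and> W \<gamma> \<xi> \<ge> 0)"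


subsection \<open>Observability-like sets\<close>

definition zeroing_set ::
  "real set \<Rightarrow> 'a set \<Rightarrow> ('a \<Rightarrow> 'a) \<Rightarrow> ('a::euclidean_space \<Rightarrow> real) \<Rightarrow> 'a set" where
  "zeroing_set J X g h =
     {\<xi> \<in> X. \<exists>\<phi>. is_autonomous_solution X g J \<phi> \<and> \<phi> 0 = \<xi> \<and> (\<forall>t\<in>J. h (\<phi> t) = 0)}"

definition fwd_inf :: "'a set \<Rightarrow> ('a \<Rightarrow> 'a) \<Rightarrow> ('a::euclidean_space \<Rightarrow> real) \<Rightarrow> 'a set" where
  "fwd_inf = zeroing_set {0..}"

definition bwd_inf :: "'a set \<Rightarrow> ('a \<Rightarrow> 'a) \<Rightarrow> ('a::euclidean_space \<Rightarrow> real) \<Rightarrow> 'a set" where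
  "bwd_inf = zeroing_set {..0}"

definition fwd :: "'a set \<Rightarrow> ('a \<Rightarrow> 'a) \<Rightarrow> ('a::euclidean_space \<Rightarrow> real) \<Rightarrow> 'a set" where
  "fwd X g h = (\<Union>\<tau>\<in>{0<..}. zeroing_set {0..\<tau>} X g h)"

definition bwd :: "'a set \<Rightarrow> ('a \<Rightarrow> 'a) \<Rightarrow> ('a::euclidean_space \<Rightarrow> real) \<Rightarrow> 'a set" where
  "bwd X g h = (\<Union>\<tau>\<in>{0<..}. zeroing_set {-\<tau>..0} X g h)"

definition cond_i ::
  "'g set \<Rightarrow> ('a::euclidean_space \<times> 'g) set \<Rightarrow> ('a \<times> 'g \<Rightarrow> 'a) \<Rightarrow>
   ('a \<times> 'g) set \<Rightarrow> ('g \<Rightarrow> 'a \<Rightarrow> real) \<Rightarrow> bool" where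
  "cond_i \<Gamma> domf f domV W \<longleftrightarrow>
     (\<forall>\<gamma>\<in>\<Gamma>. fwd_inf (sect domf domV \<gamma>) (\<lambda>\<xi>. f (\<xi>, \<gamma>)) (W \<gamma>) \<inter>
            bwd_inf (sect domf domV \<gamma>) (\<lambda>\<xi>. f (\<xi>, \<gamma>)) (W \<gamma>) \<subseteq> {0})"

definition cond_ii ::
  "'g set \<Rightarrow> ('a::euclidean_space \<times> 'g) set \<Rightarrow> ('a \<times> 'g \<Rightarrow> 'a) \<Rightarrow>
   ('a \<times> 'g) set \<Rightarrow> ('g \<Rightarrow> 'a \<Rightarrow> real) \<Rightarrow> bool" where
  "cond_ii \<Gamma> domf f domV W \<longleftrightarrow>
     (\<forall>\<gamma>\<in>\<Gamma>. \<forall>\<gamma>'\<in>\<Gamma>. \<gamma> \<noteq> \<gamma>' \<longrightarrow>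
        bwd (sect domf domV \<gamma>) (\<lambda>\<xi>. f (\<xi>, \<gamma>)) (W \<gamma>) \<inter>
        fwd (sect domf domV \<gamma>') (\<lambda>\<xi>. f (\<xi>, \<gamma>')) (W \<gamma>') \<subseteq> {0})"

definition cond_ii' ::
  "'g set \<Rightarrow> ('a::euclidean_space \<times> 'g) set \<Rightarrow> ('a \<times> 'g \<Rightarrow> 'a) \<Rightarrow>
   ('a \<times> 'g) set \<Rightarrow> ('a \<times> 'g \<Rightarrow> real) \<Rightarrow> ('g \<Rightarrow> 'a \<Rightarrow> real) \<Rightarrow> bool" where
  "cond_ii' \<Gamma> domf f domV V W \<longleftrightarrow>
     (\<forall>\<gamma>\<in>\<Gamma>. \<forall>\<gamma>'\<in>\<Gamma>. \<forall>c. \<gamma> \<noteq> \<gamma>' \<longrightarrow>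
        bwd (sect domf domV \<gamma>) (\<lambda>\<xi>. f (\<xi>, \<gamma>)) (W \<gamma>) \<inter>
        fwd (sect domf domV \<gamma>') (\<lambda>\<xi>. f (\<xi>, \<gamma>')) (W \<gamma>') \<inter>
        {\<xi> \<in> fiber domV \<gamma>. V (\<xi>, \<gamma>) = c} \<inter> {\<xi> \<in> fiber domV \<gamma>'. V (\<xi>, \<gamma>') = c} \<subseteq> {0})"

end

theory Submission
  imports Defs
begin

text \<open>If \<open>x\<close> does not tend to zero, translate it along times \<open>\<tau> k \<rightarrow> \<infinity>\<close> at which it stays away from
  zero and pass to a limit \<open>y\<close> on the whole line. The dwell-time bound leaves finitely many switching
  times in bounded intervals, so that near each time \<open>y\<close> consists of a left and a right arc, each
  solving one of the autonomous equations; monotonicity of \<open>v\<close> forces \<open>W = 0\<close> along these arcs.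
  Uniqueness of the zero solution shows that \<open>y\<close> never vanishes. By (ii) or (ii') the two arcs at
  each time then have the same index, which is therefore globally constant, and (i) gives
  \<open>y 0 = 0\<close>, a contradiction.\<close>

subsection \<open>Absolutely continuous functions\<close>

text \<open>The average dwell-time bound lets a fixed number of jumps bunch up arbitrarily closely,
  so several switches of the translates may merge into one time of \<open>y\<close>. The modes in
  between disappear in the limit, and at a merging time the signals need not converge. Hence only
  the arcs to the left and to the right of a time are considered, and their indices need not be
  consecutive modes of the signal. An index along \<open>y\<close> is a limit in \<Gamma>; for
  infinite \<Gamma> no translate need ever take it as a value. The derivatives of the translates are
  not known to converge, so the equation is carried to the limit through increments compared with a
  frozen right-hand side. \<open>W = 0\<close> on the arcs is obtained in two ways. Joint continuity
  of V, or finiteness of \<Gamma>, makes V constant along an arc, and differentiating gives the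
  claim. If instead \<open>W\<close> is jointly continuous, V along the translates need not converge
  to V along \<open>y\<close>; a positive value of \<open>W\<close> is then excluded by the drop of
  \<open>v\<close> that it would cause on every late translate.\<close>

lemma abs_continuous_on_lipschitz_diff:
  fixes x y :: "real \<Rightarrow> 'a::real_normed_vector"
  assumes x: "abs_continuous_on a b x" and y: "L-lipschitz_on {a..b} y"
  shows "abs_continuous_on a b (\<lambda>t. x t - y t)"
  unfolding abs_continuous_on_def
proof (intro allI impI)
  fix e :: real assume "e > 0"
  have L: "0 \<le> L" using y by (rule lipschitz_on_nonneg)
  obtain \<delta> where "\<delta> > 0" and \<delta>: "\<And>d t. d division_of t \<Longrightarrow> t \<subseteq> {a..b} \<Longrightarrow>
      (\<Sum>k\<in>d. Sup k - Inf k) < \<delta> \<Longrightarrow> (\<Sum>k\<in>d. norm (x (Sup k) - x (Inf k))) < e/2"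
    using x half_gt_zero[OF \<open>e > 0\<close>] unfolding abs_continuous_on_def by meson
  define \<eta> where "\<eta> = min \<delta> (e / (2 * (L + 1)))"
  have "\<eta> > 0" using \<open>\<delta> > 0\<close> \<open>e > 0\<close> L by (simp add: \<eta>_def)
  moreover have "(\<Sum>k\<in>d. norm ((x (Sup k) - y (Sup k)) - (x (Inf k) - y (Inf k)))) < e"
    if d: "d division_of t" "t \<subseteq> {a..b}" and s: "(\<Sum>k\<in>d. Sup k - Inf k) < \<eta>" for d t
  proof -
    have k: "Sup k \<in> {a..b} \<and> Inf k \<in> {a..b} \<and> Inf k \<le> Sup k" if kd: "k \<in> d" for k
    proof -
      have "k \<noteq> {}" "k \<subseteq> t" using division_ofD(2,3)[OF d(1) kd] by auto
      obtain u v where "k = {u..v}" using division_ofD(4)[OF d(1) kd] by (metis box_real(2))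
      moreover have "k \<subseteq> {a..b}" using \<open>k \<subseteq> t\<close> d(2) by (rule order_trans)
      ultimately show ?thesis using \<open>k \<noteq> {}\<close> by auto
    qed
    have "norm ((x (Sup k) - y (Sup k)) - (x (Inf k) - y (Inf k)))
        \<le> norm (x (Sup k) - x (Inf k)) + L * (Sup k - Inf k)" if "k \<in> d" for k
    proof -
      have "norm (y (Sup k) - y (Inf k)) \<le> L * (Sup k - Inf k)"
        using lipschitz_onD[OF y, of "Sup k" "Inf k"] k[OF that] by (auto simp: dist_norm)
      moreover have "(x (Sup k) - y (Sup k)) - (x (Inf k) - y (Inf k))
          = (x (Sup k) - x (Inf k)) - (y (Sup k) - y (Inf k))" by simp
      ultimately show ?thesis
        using norm_triangle_ineq4[of "x (Sup k) - x (Inf k)" "y (Sup k) - y (Inf k)"] by (simp only:)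
    qed
    then have "(\<Sum>k\<in>d. norm ((x (Sup k) - y (Sup k)) - (x (Inf k) - y (Inf k))))
        \<le> (\<Sum>k\<in>d. norm (x (Sup k) - x (Inf k)) + L * (Sup k - Inf k))" by (rule sum_mono)
    also have "\<dots> = (\<Sum>k\<in>d. norm (x (Sup k) - x (Inf k))) + L * (\<Sum>k\<in>d. Sup k - Inf k)"
      by (simp add: sum.distrib sum_distrib_left)
    also have "\<dots> < e/2 + e/2"
    proof (rule add_less_le_mono)
      show "(\<Sum>k\<in>d. norm (x (Sup k) - x (Inf k))) < e/2"
        using \<delta>[OF d] s by (simp add: \<eta>_def)
      have "L * (\<Sum>k\<in>d. Sup k - Inf k) \<le> L * (e / (2 * (L + 1)))"
        using s L by (intro mult_left_mono) (auto simp: \<eta>_def)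
      also have "\<dots> \<le> e/2" using L \<open>e > 0\<close> by (simp add: field_simps)
      finally show "L * (\<Sum>k\<in>d. Sup k - Inf k) \<le> e/2" .
    qed
    finally show ?thesis by simp
  qed
  ultimately show "\<exists>\<delta>>0. \<forall>d t. d division_of t \<and> t \<subseteq> {a..b} \<and> (\<Sum>k\<in>d. Sup k - Inf k) < \<delta> \<longrightarrow>
      (\<Sum>k\<in>d. norm ((x (Sup k) - y (Sup k)) - (x (Inf k) - y (Inf k)))) < e" by blast
qed

lemma lipschitz_on_imp_abs_continuous_on:
  fixes y :: "real \<Rightarrow> 'a::real_normed_vector"
  assumes "L-lipschitz_on {a..b} y"
  shows "abs_continuous_on a b y"
proof -
  have "L-lipschitz_on {a..b} (\<lambda>t. - y t)" using assms by (rule lipschitz_on_minus)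
  moreover have "abs_continuous_on a b (\<lambda>t. 0 :: 'a)"
    unfolding abs_continuous_on_def by (intro allI impI exI[of _ 1] conjI) simp_all
  ultimately have "abs_continuous_on a b (\<lambda>t. 0 - - y t)"
    by (rule abs_continuous_on_lipschitz_diff[rotated])
  then show ?thesis by simp
qed

text \<open>A gauge that is dictated by the derivative off the exceptional null set, and that confines
  the intervals tagged in the null set to an open set of small measure.\<close>

lemma abs_continuous_on_norm_bound:
  fixes x :: "real \<Rightarrow> 'a::real_normed_vector"
  assumes "a \<le> b" and x: "abs_continuous_on a b x" and N: "negligible N"
    and D: "\<And>t. t \<in> {a<..<b} - N \<Longrightarrow> (x has_vector_derivative D t) (at t) \<and> norm (D t) \<le> L"
    and "0 \<le> L"
  shows "norm (x b - x a) \<le> L * (b - a)"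
proof -
  have le: "norm (x b - x a) \<le> (L + e) * (b - a) + e" if "e > 0" for e
  proof -
    obtain \<delta> where "\<delta> > 0" and \<delta>: "\<And>d t. d division_of t \<Longrightarrow> t \<subseteq> {a..b} \<Longrightarrow>
        (\<Sum>k\<in>d. Sup k - Inf k) < \<delta> \<Longrightarrow> (\<Sum>k\<in>d. norm (x (Sup k) - x (Inf k))) < e"
      using x \<open>e > 0\<close> unfolding abs_continuous_on_def by meson
    \<comment> \<open>The endpoints join the exceptional set because derivatives are assumed only
      inside the interval.\<close>
    define M where "M = N \<union> {a, b}"
    have "negligible M" unfolding M_def using N by (intro negligible_Un) auto
    then have M0: "M \<in> null_sets lebesgue" by (simp add: negligible_iff_null_sets)
    then obtain G where G: "open G" "M \<subseteq> G" "G - M \<in> lmeasurable"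
        "emeasure lebesgue (G - M) < ennreal \<delta>"
      using sets_lebesgue_outer_open[of M \<delta>] \<open>\<delta> > 0\<close> by auto
    have Gs: "G \<in> sets lebesgue" using G(1) by (simp add: borel_open sets_completionI_sets)
    then have "emeasure lebesgue G = emeasure lebesgue (G - M)"
      using M0 by (simp add: emeasure_Diff_null_set)
    then have Gm: "emeasure lebesgue G < ennreal \<delta>" using G(4) by simp
    then have Gl: "G \<in> lmeasurable"
      using Gs by (intro fmeasurableI) (auto intro: order.strict_trans)
    have G\<delta>: "measure lebesgue G < \<delta>"
      using Gm Gl \<open>\<delta> > 0\<close> by (simp add: emeasure_eq_measure2 ennreal_less_iff)
    have "\<exists>r>0. \<forall>s. \<bar>s - t\<bar> < r \<longrightarrow> norm (x s - x t) \<le> (L + e) * \<bar>s - t\<bar>"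
      if t: "t \<in> {a..b} - M" for t
    proof -
      have t': "t \<in> {a<..<b} - N" using t by (auto simp: M_def)
      obtain r where "r > 0" and
        r: "\<And>s. norm (s - t) < r \<Longrightarrow> norm (x s - x t - (s - t) *\<^sub>R D t) \<le> e * norm (s - t)"
        using D[OF t'] \<open>e > 0\<close> unfolding has_vector_derivative_def has_derivative_at_alt by blast
      have "norm (x s - x t) \<le> (L + e) * \<bar>s - t\<bar>" if "\<bar>s - t\<bar> < r" for s
      proof -
        have "norm (x s - x t) \<le> norm (x s - x t - (s - t) *\<^sub>R D t) + norm ((s - t) *\<^sub>R D t)"
          by (metis diff_add_cancel norm_triangle_ineq)
        also have "\<dots> \<le> e * \<bar>s - t\<bar> + \<bar>s - t\<bar> * L"
          using r[of s] that D[OF t'] by (intro add_mono) (auto simp: mult_left_mono)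
        finally show ?thesis by (simp add: algebra_simps)
      qed
      then show ?thesis using \<open>r > 0\<close> by blast
    qed
    then obtain r where r: "\<And>t. t \<in> {a..b} - M \<Longrightarrow> r t > 0 \<and>
        (\<forall>s. \<bar>s - t\<bar> < r t \<longrightarrow> norm (x s - x t) \<le> (L + e) * \<bar>s - t\<bar>)" by metis
    define g where "g t = (if t \<in> M then G else if t \<in> {a..b} then ball t (r t) else UNIV)" for t
    have "gauge g" unfolding gauge_def g_def using G(1,2) r by auto
    then obtain p where p: "p tagged_division_of {a..b}" "g fine p"
      using fine_division_exists_real by blast
    note pD = tagged_division_ofD[OF p(1)]
    have int: "\<exists>u v. K = {u..v} \<and> u \<le> t \<and> t \<le> v \<and> a \<le> u \<and> v \<le> b" if tk: "(t, K) \<in> p" for t K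
    proof -
      obtain u v where "K = {u..v}" using pD(4)[OF tk] by (metis box_real(2))
      moreover have "t \<in> K" "K \<subseteq> {a..b}" using pD(2,3)[OF tk] by auto
      ultimately show ?thesis by auto
    qed
    define p1 where "p1 = {tk \<in> p. fst tk \<in> M}"
    define p2 where "p2 = {tk \<in> p. fst tk \<notin> M}"
    have fin: "finite p1" "finite p2" "p1 \<inter> p2 = {}" "p = p1 \<union> p2"
      using pD(1) by (auto simp: p1_def p2_def)
    have pp1: "p1 tagged_partial_division_of {a..b}"
      using p(1) by (rule tagged_partial_division_subset[OF tagged_division_of_def[THEN iffD1, THEN conjunct1]])
        (auto simp: p1_def)
    note p1t = tagged_partial_division_of_Union_self[OF pp1]
    note p1d = partial_division_of_tagged_division[OF pp1]
    have b1: "(\<Sum>(t,K)\<in>p1. norm (x (Sup K) - x (Inf K))) < e"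
    proof -
      have "(\<Sum>(t,K)\<in>p1. norm (x (Sup K) - x (Inf K))) = (\<Sum>K\<in>snd ` p1. norm (x (Sup K) - x (Inf K)))"
      proof -
        \<comment> \<open>Passing from tagged pairs to their intervals requires a summand that
          vanishes on every box with empty interior. One of these boxes is empty, where
          \<open>Sup\<close> and \<open>Inf\<close> carry no meaning; hence the default 0. It never
          enters the sums, as a tagged interval contains its tag.\<close>
        define d where "d K = (if K = {} then 0 else norm (x (Sup K) - x (Inf K)))" for K
        have "d (cbox u v) = 0" if "box u v = {}" for u v
          using that by (auto simp: d_def)
        then have "(\<Sum>(t,K)\<in>p1. d K) = (\<Sum>K\<in>snd ` p1. d K)"
          by (rule sum.over_tagged_division_lemma[OF p1t])
        moreover have dK: "d K = norm (x (Sup K) - x (Inf K))" if "(t, K) \<in> p1" for t K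
          using pD(2)[of t K] that by (auto simp: d_def p1_def)
        have "(\<Sum>(t,K)\<in>p1. d K) = (\<Sum>(t,K)\<in>p1. norm (x (Sup K) - x (Inf K)))"
          by (rule sum.cong) (auto dest: dK)
        moreover have "(\<Sum>K\<in>snd ` p1. d K) = (\<Sum>K\<in>snd ` p1. norm (x (Sup K) - x (Inf K)))"
          by (rule sum.cong) (auto dest: dK)
        ultimately show ?thesis by simp
      qed
      also have "\<dots> < e"
      proof (rule \<delta>[OF p1d])
        show "\<Union> (snd ` p1) \<subseteq> {a..b}" using pD(3) unfolding p1_def by fastforce
        have "(\<Sum>K\<in>snd ` p1. Sup K - Inf K) = (\<Sum>K\<in>snd ` p1. measure lebesgue K)"
        proof (rule sum.cong[OF refl])
          fix K assume "K \<in> snd ` p1"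
          then obtain t where "(t, K) \<in> p" by (auto simp: p1_def)
          then show "Sup K - Inf K = measure lebesgue K" using int by fastforce
        qed
        also have "\<dots> = measure lebesgue (\<Union> (snd ` p1))" by (rule content_division[OF p1d])
        also have "\<dots> \<le> measure lebesgue G"
        proof (rule measure_mono_fmeasurable[OF _ _ Gl])
          show "\<Union> (snd ` p1) \<subseteq> G"
            using p(2) unfolding fine_def p1_def g_def by fastforce
          show "\<Union> (snd ` p1) \<in> sets lebesgue" using lmeasurable_division[OF p1d] by auto
        qed
        finally show "(\<Sum>K\<in>snd ` p1. Sup K - Inf K) < \<delta>" using G\<delta> by simp
      qed
      finally show ?thesis .
    qed
    have b2: "(\<Sum>(t,K)\<in>p2. norm (x (Sup K) - x (Inf K))) \<le> (L + e) * (b - a)"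
    proof -
      have "(\<Sum>(t,K)\<in>p2. norm (x (Sup K) - x (Inf K))) \<le> (\<Sum>(t,K)\<in>p2. (L + e) * (Sup K - Inf K))"
      proof (rule sum_mono, clarify)
        fix t K assume "(t, K) \<in> p2"
        then have tk: "(t, K) \<in> p" "t \<notin> M" by (auto simp: p2_def)
        obtain u v where uv: "K = {u..v}" "u \<le> t" "t \<le> v" "a \<le> u" "v \<le> b" using int[OF tk(1)] by auto
        have t: "t \<in> {a..b} - M" using uv tk by auto
        have "K \<subseteq> g t" using p(2) tk(1) unfolding fine_def by blast
        then have "K \<subseteq> ball t (r t)" using t by (auto simp: g_def)
        moreover have "u \<in> K" "v \<in> K" using uv by auto
        ultimately have "u \<in> ball t (r t)" "v \<in> ball t (r t)" by blast+
        then have "\<bar>u - t\<bar> < r t" "\<bar>v - t\<bar> < r t"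
          by (simp_all add: dist_real_def abs_minus_commute)
        then have "norm (x u - x t) \<le> (L + e) * (t - u)" "norm (x v - x t) \<le> (L + e) * (v - t)"
          using r[OF t] uv by fastforce+
        moreover have "norm (x v - x u) \<le> norm (x v - x t) + norm (x u - x t)"
          using norm_triangle_ineq4[of "x v - x t" "x u - x t"] by simp
        ultimately show "norm (x (Sup K) - x (Inf K)) \<le> (L + e) * (Sup K - Inf K)"
          using uv by (simp add: algebra_simps)
      qed
      also have "\<dots> \<le> (\<Sum>(t,K)\<in>p. (L + e) * (Sup K - Inf K))"
      proof (rule sum_mono2)
        show "finite p" "p2 \<subseteq> p" using pD(1) by (auto simp: p2_def)
        fix tk assume "tk \<in> p - p2"
        then obtain t K where "tk = (t, K)" "(t, K) \<in> p" by (cases tk) auto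
        then show "0 \<le> (case tk of (t, K) \<Rightarrow> (L + e) * (Sup K - Inf K))"
          using int \<open>0 \<le> L\<close> \<open>e > 0\<close> by fastforce
      qed
      also have "\<dots> = (L + e) * (\<Sum>(t,K)\<in>p. Sup K - Inf K)"
        by (simp add: sum_distrib_left split_def)
      also have "(\<Sum>(t,K)\<in>p. Sup K - Inf K) = b - a"
        using additive_tagged_division_1[OF \<open>a \<le> b\<close> p(1), of "\<lambda>x. x"] by simp
      finally show ?thesis .
    qed
    have "norm (x b - x a) = norm (\<Sum>(t,K)\<in>p. x (Sup K) - x (Inf K))"
      by (simp add: additive_tagged_division_1[OF \<open>a \<le> b\<close> p(1)])
    also have "\<dots> \<le> (\<Sum>(t,K)\<in>p. norm (x (Sup K) - x (Inf K)))"
      by (rule order_trans[OF norm_sum]) (simp add: split_def)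
    also have "\<dots> = (\<Sum>(t,K)\<in>p1. norm (x (Sup K) - x (Inf K))) + (\<Sum>(t,K)\<in>p2. norm (x (Sup K) - x (Inf K)))"
      using fin by (simp add: sum.union_disjoint)
    finally show ?thesis using b1 b2 by simp
  qed
  show ?thesis
  proof (rule field_le_epsilon)
    fix e :: real assume "e > 0"
    \<comment> \<open>With this choice the excess \<open>\<eta> * (b - a) + \<eta>\<close> in
      \<open>le\<close> equals \<open>e\<close>.\<close>
    define \<eta> where "\<eta> = e / (b - a + 1)"
    have "\<eta> > 0" using \<open>e > 0\<close> \<open>a \<le> b\<close> by (simp add: \<eta>_def)
    have "\<eta> * (b - a + 1) = e" using \<open>a \<le> b\<close> by (simp add: \<eta>_def)
    then show "norm (x b - x a) \<le> L * (b - a) + e"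
      using le[OF \<open>\<eta> > 0\<close>] by (simp add: algebra_simps)
  qed
qed

text \<open>On a limit arc the signals are controlled only strictly inside the interval, whereas the
  derivative is wanted up to the endpoints. An estimate on increments between two interior points is
  stable under limits of these points, so continuity of \<open>y\<close> extends it to increments
  that start at \<open>t\<close>, even if \<open>t\<close> is an endpoint.\<close>

lemma has_vector_derivative_within_Icc_from_interior:
  fixes y :: "real \<Rightarrow> 'a::real_normed_vector"
  assumes "a < b" and cont: "continuous_on {a..b} y" and t: "t \<in> {a..b}"
    and est: "\<And>e. e > 0 \<Longrightarrow> \<exists>\<eta>>0. \<forall>p q. a < p \<and> p < q \<and> q < b \<and> \<bar>p - t\<bar> < \<eta> \<and> \<bar>q - t\<bar> < \<eta> \<longrightarrow>
        norm (y q - y p - (q - p) *\<^sub>R c) \<le> e * (q - p)"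
  shows "(y has_vector_derivative c) (at t within {a..b})"
  unfolding has_vector_derivative_def has_derivative_within_alt
proof (intro conjI allI impI)
  show "bounded_linear (\<lambda>h. h *\<^sub>R c)" by (rule bounded_linear_scaleR_left)
  fix e :: real assume "e > 0"
  then obtain \<eta> where "\<eta> > 0" and \<eta>: "\<And>p q. a < p \<Longrightarrow> p < q \<Longrightarrow> q < b \<Longrightarrow> \<bar>p - t\<bar> < \<eta> \<Longrightarrow> \<bar>q - t\<bar> < \<eta> \<Longrightarrow>
        norm (y q - y p - (q - p) *\<^sub>R c) \<le> e * (q - p)" using est by meson
  have closed_est: "norm (y q - y p - (q - p) *\<^sub>R c) \<le> e * (q - p)"
    if pq: "a \<le> p" "p < q" "q \<le> b" "\<bar>p - t\<bar> < \<eta>" "\<bar>q - t\<bar> < \<eta>" for p q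
  proof -
    define m where "m = (p + q) / 2"
    \<comment> \<open>\<open>P u\<close> and \<open>Q u\<close> move \<open>p\<close> and
      \<open>q\<close> towards their midpoint: for \<open>0 < u < 1\<close> they are interior and
      keep their order, and they return to \<open>p\<close> and \<open>q\<close> as \<open>u\<close>
      tends to 0.\<close>
    define P where "P u = p + u * (m - p)" for u
    define Q where "Q u = q - u * (q - m)" for u
    have mm: "p < m" "m < q" using pq by (auto simp: m_def)
    have PQ: "a < P u \<and> P u < m \<and> \<bar>P u - t\<bar> < \<eta> \<and> m < Q u \<and> Q u < b \<and> \<bar>Q u - t\<bar> < \<eta>"
      if u: "0 < u" "u < 1" for u
    proof -
      have "0 < u * (m - p)" "u * (m - p) < m - p" "0 < u * (q - m)" "u * (q - m) < q - m"
        using u mm by auto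
      then show ?thesis using pq mm unfolding P_def Q_def abs_less_iff by (intro conjI) linarith+
    qed
    have ev: "\<forall>\<^sub>F u in at_right (0::real). 0 < u \<and> u < 1"
      by (simp add: eventually_at_right_field) (meson zero_less_one)
    have tP: "(P \<longlongrightarrow> p) (at_right 0)" and tQ: "(Q \<longlongrightarrow> q) (at_right 0)"
      unfolding P_def Q_def by (auto intro!: tendsto_eq_intros)
    have "\<forall>\<^sub>F u in at_right 0. P u \<in> {a..b}" "\<forall>\<^sub>F u in at_right 0. Q u \<in> {a..b}"
      by (rule eventually_mono[OF ev], use PQ pq mm in fastforce)+
    then have "((\<lambda>u. y (P u)) \<longlongrightarrow> y p) (at_right 0)" "((\<lambda>u. y (Q u)) \<longlongrightarrow> y q) (at_right 0)"
      using pq by (auto intro: continuous_on_tendsto_compose[OF cont tP] continuous_on_tendsto_compose[OF cont tQ])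
    then have "((\<lambda>u. norm (y (Q u) - y (P u) - (Q u - P u) *\<^sub>R c)) \<longlongrightarrow> norm (y q - y p - (q - p) *\<^sub>R c)) (at_right 0)"
      by (intro tendsto_intros tP tQ)
    moreover have "((\<lambda>u. e * (Q u - P u)) \<longlongrightarrow> e * (q - p)) (at_right 0)"
      by (intro tendsto_intros tP tQ)
    moreover have "\<forall>\<^sub>F u in at_right 0. norm (y (Q u) - y (P u) - (Q u - P u) *\<^sub>R c) \<le> e * (Q u - P u)"
      using ev
    proof eventually_elim
      case (elim u)
      then show ?case using PQ[of u] by (intro \<eta>) auto
    qed
    ultimately show ?thesis by (intro tendsto_le[of "at_right (0::real)"]) auto
  qed
  have "norm (y s - y t - (s - t) *\<^sub>R c) \<le> e * norm (s - t)" if s: "s \<in> {a..b}" "norm (s - t) < \<eta>" for s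
  proof (cases s t rule: linorder_cases)
    case less
    then have "norm (y t - y s - (t - s) *\<^sub>R c) \<le> e * (t - s)" using s t \<open>\<eta> > 0\<close> by (intro closed_est) auto
    moreover have "norm (y s - y t - (s - t) *\<^sub>R c) = norm (y t - y s - (t - s) *\<^sub>R c)"
      by (subst norm_minus_cancel[symmetric]) (simp add: algebra_simps)
    ultimately show ?thesis using less by simp
  next
    case greater
    then show ?thesis using closed_est[of t s] s t \<open>\<eta> > 0\<close> by auto
  qed auto
  then show "\<exists>d>0. \<forall>s\<in>{a..b}. norm (s - t) < d \<longrightarrow> norm (y s - y t - (s - t) *\<^sub>R c) \<le> e * norm (s - t)"
    using \<open>\<eta> > 0\<close> by blast
qed

section \<open>Compactness, gradients and monotone limits\<close>

text \<open>No explicit diagonal is built: a product of compact sets is compact, and a countable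
  product of metric spaces is metrizable, so sequential compactness yields one subsequence for all
  coordinates.\<close>

lemma diagonal_subsequence:
  fixes F :: "nat \<Rightarrow> 'i::countable \<Rightarrow> 'b::metric_space"
  assumes K: "\<And>i. compact (K i)" and F: "\<And>n i. F n i \<in> K i"
  obtains r l where "strict_mono (r :: nat \<Rightarrow> nat)" "\<And>i. l i \<in> K i" "\<And>i. (\<lambda>n. F (r n) i) \<longlonglongrightarrow> l i"
proof -
  have "compactin (product_topology (\<lambda>i. euclidean) UNIV) (PiE UNIV K)"
    using K by (simp add: compactin_PiE)
  then have "compact (PiE UNIV K)" by (simp add: euclidean_product_topology)
  then have "seq_compact (PiE UNIV K)" by (simp add: compact_eq_seq_compact_metric)
  moreover have "\<forall>n. F n \<in> PiE UNIV K" using F by auto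
  ultimately obtain l r where l: "l \<in> PiE UNIV K" "strict_mono (r :: nat \<Rightarrow> nat)" "(F \<circ> r) \<longlonglongrightarrow> l"
    by (rule seq_compactE)
  have "(\<lambda>n. F (r n) i) \<longlonglongrightarrow> l i" for i
  proof -
    have "isCont (\<lambda>f. f i) l"
      by (metis UNIV_I continuous_on_eq_continuous_at continuous_on_product_coordinates open_UNIV)
    then show ?thesis using l(3) isCont_tendsto_compose by (fastforce simp: o_def)
  qed
  then show thesis using that[OF l(2), of l] l(1) by auto
qed

lemma is_autonomous_solutionI_lipschitz:
  assumes "is_interval J" "J \<noteq> {}" "L-lipschitz_on J y"
    and "\<And>t. t \<in> J \<Longrightarrow> y t \<in> X" "\<And>t. t \<in> J \<Longrightarrow> (y has_vector_derivative g (y t)) (at t within J)"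
  shows "is_autonomous_solution X g J y"
proof -
  have "loc_abs_continuous_on J y"
    unfolding loc_abs_continuous_on_def
    by (meson assms(3) lipschitz_on_subset lipschitz_on_imp_abs_continuous_on)
  then show ?thesis unfolding is_solution_def using assms by simp
qed

text \<open>The coordinates of the derivative supply a representing vector, and uniqueness of the
  derivative makes the definite description in \<open>grad\<close> pick it.\<close>

lemma GDERIV_grad:
  fixes F :: "'a::euclidean_space \<Rightarrow> real"
  assumes "F differentiable (at \<xi>)"
  shows "GDERIV F \<xi> :> grad F \<xi>"
proof -
  obtain F' where F': "(F has_derivative F') (at \<xi>)" using assms by (auto simp: differentiable_def)
  then interpret bounded_linear F' by (rule has_derivative_bounded_linear)
  define D where "D = (\<Sum>b\<in>Basis. F' b *\<^sub>R b)"
  have "F' h = h \<bullet> D" for h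
  proof -
    have "F' h = F' (\<Sum>b\<in>Basis. (h \<bullet> b) *\<^sub>R b)" by (simp add: euclidean_representation)
    also have "\<dots> = h \<bullet> D" by (simp add: sum scaleR D_def inner_sum_right mult.commute)
    finally show ?thesis .
  qed
  then have "F' = (\<lambda>h. h \<bullet> D)" by (rule ext)
  then have D: "GDERIV F \<xi> :> D" using F' by (simp only: gderiv_def)
  show ?thesis unfolding grad_def
  proof (rule theI[where P = "\<lambda>D. GDERIV F \<xi> :> D", OF D])
    fix E assume "GDERIV F \<xi> :> E"
    then have "(\<lambda>h. h \<bullet> E) = (\<lambda>h. h \<bullet> D)"
      using D unfolding gderiv_def by (rule has_derivative_unique)
    then have "\<forall>h. h \<bullet> E = h \<bullet> D" unfolding fun_eq_iff .
    then show "E = D" by (rule vector_eq_ldot[THEN iffD1])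
  qed
qed

text \<open>The limit is the same for all sequences \<open>u\<close>; this is what later makes V
  constant along limits of translates. \<open>S\<close> need not be an interval: for finite \<Gamma>
  it is the set of nonnegative times at which one index is active.\<close>

lemma antimono_on_bounded_tendsto:
  fixes v :: "real \<Rightarrow> real"
  assumes v: "antimono_on S v" and bdd: "bdd_below (v ` S)"
    and u: "filterlim u at_top sequentially" and S: "\<forall>\<^sub>F k in sequentially. u k \<in> S"
  shows "(\<lambda>k. v (u k)) \<longlonglongrightarrow> Inf (v ` S)"
proof (rule order_tendstoI)
  fix c assume "c < Inf (v ` S)"
  show "\<forall>\<^sub>F k in sequentially. c < v (u k)"
    by (rule eventually_mono[OF S]) (use cINF_lower[OF bdd] \<open>c < Inf (v ` S)\<close> in force)
next
  fix c assume c: "Inf (v ` S) < c"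
  have "S \<noteq> {}" using S eventually_happens by fastforce
  then obtain s where s: "s \<in> S" "v s < c" using c bdd by (auto simp: cInf_less_iff)
  have "\<forall>\<^sub>F k in sequentially. s \<le> u k" using u by (simp add: filterlim_at_top)
  then show "\<forall>\<^sub>F k in sequentially. v (u k) < c"
    using S
  proof eventually_elim
    case (elim k)
    then show ?case using monotone_onD[OF v s(1), of "u k"] s(2) by simp
  qed
qed

subsection \<open>Limits of translated trajectories\<close>

locale bounded_trajectory =
  fixes \<Gamma> :: "'g::metric_space set"
    and domf :: "('a::euclidean_space \<times> 'g) set"
    and f :: "'a \<times> 'g \<Rightarrow> 'a"
    and x :: "real \<Rightarrow> 'a"
    and \<sigma> :: "real \<Rightarrow> 'g"
    and J :: "real set"
    and B :: "'a set"
  assumes compact_\<Gamma>: "compact \<Gamma>"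
    and closed_domf: "closed domf"
    and continuous_f: "continuous_on domf f"
    and traj: "trajectory \<Gamma> domf f J x \<sigma>"
    and J: "{0..} \<subseteq> J"
    and compact_B: "compact B"
    and x_in_B: "\<And>t. t \<in> J \<Longrightarrow> x t \<in> B"
begin

lemma switching_signal: "switching_signal \<Gamma> \<sigma>"
  using traj by (simp add: trajectory_def)

lemma \<sigma>_in: "\<sigma> t \<in> \<Gamma>"
  using switching_signal by (auto simp: switching_signal_def)

lemma x_in: "0 \<le> t \<Longrightarrow> x t \<in> B"
  using x_in_B J by auto

lemma x_\<sigma>_in: "0 \<le> t \<Longrightarrow> (x t, \<sigma> t) \<in> domf"
  using traj J by (auto simp: trajectory_def is_solution_def fiber_def)

lemma compact_domf_B: "compact (domf \<inter> (B \<times> \<Gamma>))"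
  using closed_domf compact_B compact_\<Gamma> by (simp add: closed_Int_compact compact_Times)

lemma f_bound: obtains L where "0 \<le> L" "\<And>t. 0 \<le> t \<Longrightarrow> norm (f (x t, \<sigma> t)) \<le> L"
proof -
  have "bounded (f ` (domf \<inter> (B \<times> \<Gamma>)))"
    by (intro compact_imp_bounded compact_continuous_image continuous_on_subset[OF continuous_f]
        compact_domf_B) auto
  then obtain L where L: "\<And>z. z \<in> domf \<inter> (B \<times> \<Gamma>) \<Longrightarrow> norm (f z) \<le> L"
    unfolding bounded_iff by auto
  moreover have "(x t, \<sigma> t) \<in> domf \<inter> (B \<times> \<Gamma>)" if "0 \<le> t" for t
    using that x_in x_\<sigma>_in \<sigma>_in by auto
  ultimately show thesis
    using that[of L] norm_ge_zero[of "f (x 0, \<sigma> 0)"] by (meson order_refl order_trans)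
qed

text \<open>The differential equation in a form that survives pointwise limits of translates:
  increments are compared with a frozen vector \<open>c\<close>, and no derivative of
  \<open>x\<close> occurs. With \<open>c = 0\<close> it yields the Lipschitz bound.\<close>

lemma mean_estimate:
  assumes "0 \<le> p" "p \<le> q" "0 \<le> e"
    and e: "\<And>s. s \<in> {p<..<q} \<Longrightarrow> norm (f (x s, \<sigma> s) - c) \<le> e"
  shows "norm (x q - x p - (q - p) *\<^sub>R c) \<le> e * (q - p)"
proof -
  have sol: "loc_abs_continuous_on J x"
    "AE t in lebesgue. t \<in> J \<longrightarrow> (x has_vector_derivative f (x t, \<sigma> t)) (at t within J)"
    using traj by (auto simp: trajectory_def is_solution_def)
  obtain N where N0: "\<And>t. t \<in> space lebesgue - N \<Longrightarrow>
      t \<in> J \<longrightarrow> (x has_vector_derivative f (x t, \<sigma> t)) (at t within J)" "N \<in> null_sets lebesgue"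
    using AE_E3[OF sol(2)] by metis
  then have N: "negligible N"
    "\<And>t. t \<in> J - N \<Longrightarrow> (x has_vector_derivative f (x t, \<sigma> t)) (at t within J)"
    by (simp_all add: negligible_iff_null_sets)
  \<comment> \<open>Subtracting the motion with constant velocity \<open>c\<close> leaves an
    absolutely continuous function whose derivative has norm at most \<open>e\<close> almost
    everywhere.\<close>
  define z where "z t = x t - t *\<^sub>R c" for t
  have "abs_continuous_on p q x"
  proof -
    have "{p..q} \<subseteq> J" using J assms(1) by auto
    then show ?thesis using sol(1) unfolding loc_abs_continuous_on_def by blast
  qed
  moreover have "(norm c)-lipschitz_on {p..q} (\<lambda>t. t *\<^sub>R c)"
    by (rule lipschitz_onI) (auto simp: dist_norm mult.commute simp flip: scaleR_left_diff_distrib)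
  ultimately have "abs_continuous_on p q z"
    unfolding z_def[abs_def] by (rule abs_continuous_on_lipschitz_diff)
  moreover have "(z has_vector_derivative f (x t, \<sigma> t) - c) (at t) \<and> norm (f (x t, \<sigma> t) - c) \<le> e"
    if t: "t \<in> {p<..<q} - N" for t
  proof
    have "{p<..<q} \<subseteq> J" using J assms(1) by auto
    then have "(x has_vector_derivative f (x t, \<sigma> t)) (at t within {p<..<q})"
      using t by (intro has_vector_derivative_within_subset[OF N(2)]) auto
    then have "(x has_vector_derivative f (x t, \<sigma> t)) (at t)"
      using t at_within_open[of t "{p<..<q}"] by simp
    then show "(z has_vector_derivative f (x t, \<sigma> t) - c) (at t)"
      unfolding z_def[abs_def] by (auto intro!: derivative_eq_intros)
  qed (use e t in auto)
  ultimately have "norm (z q - z p) \<le> e * (q - p)"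
    using assms(3) by (intro abs_continuous_on_norm_bound[OF assms(2) _ N(1)])
  then show ?thesis by (simp add: z_def algebra_simps)
qed

lemma x_lipschitz: obtains L where "0 \<le> L" "L-lipschitz_on {0..} x"
proof -
  obtain L where L: "0 \<le> L" "\<And>t. 0 \<le> t \<Longrightarrow> norm (f (x t, \<sigma> t)) \<le> L" using f_bound by blast
  have "dist (x p) (x q) \<le> L * dist p q" if "0 \<le> p" "p \<le> q" for p q
    using mean_estimate[OF that L(1), of 0] L(2) that by (auto simp: dist_norm norm_minus_commute)
  then have "dist (x p) (x q) \<le> L * dist p q" if "0 \<le> p" "0 \<le> q" for p q
    using that by (metis dist_commute linear)
  then have "L-lipschitz_on {0..} x"
    using L(1) by (intro lipschitz_onI) auto
  then show thesis using that L by blast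
qed

text \<open>Limits of the trajectory along time shifts, on an interval in whose interior the shifted
  signals are eventually constant. The shifts need not tend to infinity: the zero shift yields the
  arcs of the trajectory itself between jumps.\<close>

definition limit_arc :: "(nat \<Rightarrow> real) \<Rightarrow> (real \<Rightarrow> 'a) \<Rightarrow> real \<Rightarrow> real \<Rightarrow> 'g \<Rightarrow> bool" where
  "limit_arc \<tau> y a b \<gamma> \<longleftrightarrow> a < b \<and> (\<forall>\<^sub>F k in sequentially. 0 \<le> \<tau> k + a) \<and>
     (\<forall>s\<in>{a..b}. (\<lambda>k. x (\<tau> k + s)) \<longlonglongrightarrow> y s) \<and>
     (\<forall>s\<in>{a<..<b}. (\<lambda>k. \<sigma> (\<tau> k + s)) \<longlonglongrightarrow> \<gamma>) \<and>
     (\<forall>p q. a < p \<and> p < q \<and> q < b \<longrightarrow>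
        (\<forall>\<^sub>F k in sequentially. \<sigma> constant_on {\<tau> k + p<..<\<tau> k + q}))"

lemma limit_arcD:
  assumes "limit_arc \<tau> y a b \<gamma>"
  shows "a < b" and "\<And>s. a \<le> s \<Longrightarrow> \<forall>\<^sub>F k in sequentially. 0 \<le> \<tau> k + s"
    and "\<And>s. s \<in> {a..b} \<Longrightarrow> (\<lambda>k. x (\<tau> k + s)) \<longlonglongrightarrow> y s"
    and "\<And>s. s \<in> {a<..<b} \<Longrightarrow> (\<lambda>k. \<sigma> (\<tau> k + s)) \<longlonglongrightarrow> \<gamma>"
    and "\<And>p q. a < p \<Longrightarrow> p < q \<Longrightarrow> q < b \<Longrightarrow>
        \<forall>\<^sub>F k in sequentially. \<sigma> constant_on {\<tau> k + p<..<\<tau> k + q}"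
    and "\<gamma> \<in> \<Gamma>"
proof -
  have ab: "a < b" and 0: "\<forall>\<^sub>F k in sequentially. 0 \<le> \<tau> k + a" using assms by (auto simp: limit_arc_def)
  show "a < b" by fact
  show "\<forall>\<^sub>F k in sequentially. 0 \<le> \<tau> k + s" if "a \<le> s" for s
    using 0 by eventually_elim (use that in linarith)
  show "(\<lambda>k. x (\<tau> k + s)) \<longlonglongrightarrow> y s" if "s \<in> {a..b}" for s
    using assms that by (auto simp: limit_arc_def)
  show \<sigma>: "(\<lambda>k. \<sigma> (\<tau> k + s)) \<longlonglongrightarrow> \<gamma>" if "s \<in> {a<..<b}" for s
    using assms that by (auto simp: limit_arc_def)
  show "\<forall>\<^sub>F k in sequentially. \<sigma> constant_on {\<tau> k + p<..<\<tau> k + q}" if "a < p" "p < q" "q < b" for p q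
    using assms that by (auto simp: limit_arc_def)
  show "\<gamma> \<in> \<Gamma>"
    using closed_sequentially[OF compact_imp_closed[OF compact_\<Gamma>] _ \<sigma>[of "(a + b) / 2"]] \<sigma>_in ab by auto
qed

lemma limit_arc_in:
  assumes "limit_arc \<tau> y a b \<gamma>" "s \<in> {a..b}"
  shows "y s \<in> B"
proof -
  note D = limit_arcD[OF assms(1)]
  have "\<forall>\<^sub>F k in sequentially. x (\<tau> k + s) \<in> B"
    using D(2)[of s] assms(2) by (auto elim!: eventually_mono intro: x_in)
  then show ?thesis
    by (rule Lim_in_closed_set[OF compact_imp_closed[OF compact_B] _ _ D(3)[OF assms(2)]]) simp
qed

lemma limit_lipschitz:
  assumes "\<And>s. s \<in> S \<Longrightarrow> \<forall>\<^sub>F k in sequentially. 0 \<le> \<tau> k + s"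
    and "\<And>s. s \<in> S \<Longrightarrow> (\<lambda>k. x (\<tau> k + s)) \<longlonglongrightarrow> y s"
    and L: "L-lipschitz_on {0..} x"
  shows "L-lipschitz_on S y"
proof (rule lipschitz_onI)
  fix p q assume pq: "p \<in> S" "q \<in> S"
  have "(\<lambda>k. dist (x (\<tau> k + p)) (x (\<tau> k + q))) \<longlonglongrightarrow> dist (y p) (y q)"
    by (intro tendsto_dist assms(2) pq)
  moreover have "\<forall>\<^sub>F k in sequentially. dist (x (\<tau> k + p)) (x (\<tau> k + q)) \<le> L * dist p q"
    using assms(1)[OF pq(1)] assms(1)[OF pq(2)]
  proof eventually_elim
    case (elim k)
    then show ?case using lipschitz_onD[OF L, of "\<tau> k + p" "\<tau> k + q"] by simp
  qed
  ultimately show "dist (y p) (y q) \<le> L * dist p q"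
    by (intro tendsto_upperbound) auto
qed (rule lipschitz_on_nonneg[OF L])

lemma limit_arc_lipschitz:
  assumes "limit_arc \<tau> y a b \<gamma>" "L-lipschitz_on {0..} x"
  shows "L-lipschitz_on {a..b} y"
  by (rule limit_lipschitz[OF _ limit_arcD(3)[OF assms(1)] assms(2)])
    (auto intro: limit_arcD(2)[OF assms(1)])

lemma limit_arc_continuous:
  assumes "limit_arc \<tau> y a b \<gamma>"
  shows "continuous_on {a..b} y"
proof -
  obtain L where "L-lipschitz_on {0..} x" using x_lipschitz by blast
  from limit_arc_lipschitz[OF assms this] show ?thesis by (rule lipschitz_on_continuous_on)
qed

text \<open>Inside the interval both states and signals converge, and \<open>domf\<close> is closed.
  At the endpoints the signals are not assumed to converge, so these are reached by continuity of
  \<open>y\<close>.\<close>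

lemma limit_arc_domf:
  assumes "limit_arc \<tau> y a b \<gamma>" "s \<in> {a..b}"
  shows "(y s, \<gamma>) \<in> domf"
proof -
  note D = limit_arcD[OF assms(1)]
  have "(y s, \<gamma>) \<in> domf" if s: "s \<in> {a<..<b}" for s
  proof -
    have "(\<lambda>k. (x (\<tau> k + s), \<sigma> (\<tau> k + s))) \<longlonglongrightarrow> (y s, \<gamma>)"
      using D(3,4)[of s] s by (intro tendsto_Pair) auto
    moreover have "\<forall>\<^sub>F k in sequentially. (x (\<tau> k + s), \<sigma> (\<tau> k + s)) \<in> domf"
      using D(2)[of s] s by (auto elim!: eventually_mono intro: x_\<sigma>_in)
    ultimately show ?thesis
      by (intro Lim_in_closed_set[OF closed_domf _ trivial_limit_sequentially])
  qed
  moreover have "closure {a<..<b} = {a..b}" using D(1) by (rule closure_greaterThanLessThan)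
  moreover have "continuous_on {a..b} (\<lambda>s. (y s, \<gamma>))"
    by (intro continuous_intros limit_arc_continuous[OF assms(1)])
  ultimately show ?thesis
    using image_closure_subset[of "{a<..<b}" "\<lambda>s. (y s, \<gamma>)" domf] closed_domf assms(2)
    by (simp add: image_subset_iff)
qed

text \<open>Pointwise convergence becomes uniform on a short window: it is invoked only at the left
  end \<open>p\<close>, and on the rest of \<open>{p..q}\<close> the Lipschitz bound controls the
  states and constancy the signals.\<close>

lemma limit_arc_near:
  assumes "limit_arc \<tau> y a b \<gamma>" "t \<in> {a..b}" "0 < r"
  obtains \<eta> where "0 < \<eta>"
    "\<And>p q. a < p \<Longrightarrow> p < q \<Longrightarrow> q < b \<Longrightarrow> \<bar>p - t\<bar> < \<eta> \<Longrightarrow> \<bar>q - t\<bar> < \<eta> \<Longrightarrow>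
      \<forall>\<^sub>F k in sequentially. 0 \<le> \<tau> k + a \<and>
        (\<forall>s\<in>{p..q}. \<sigma> (\<tau> k + s) = \<sigma> (\<tau> k + p) \<and>
           dist (x (\<tau> k + s), \<sigma> (\<tau> k + s)) (y t, \<gamma>) < r)"
proof -
  note D = limit_arcD[OF assms(1)]
  obtain L where L: "0 \<le> L" "L-lipschitz_on {0..} x" using x_lipschitz by blast
  note yL = limit_arc_lipschitz[OF assms(1) L(2)]
  \<comment> \<open>The drift of a translate over the window is at most \<open>r / 4\<close>, its
    error at \<open>p\<close> is below \<open>r / 4\<close>, the drift of \<open>y\<close> is at
    most \<open>r / 8\<close>, and the signals are off by less than \<open>r / 4\<close>; together
    this stays below \<open>r\<close>. The summand 1 admits \<open>L = 0\<close>.\<close>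
  define \<eta> where "\<eta> = r / (8 * (L + 1))"
  have "\<eta> > 0" using assms(3) L by (simp add: \<eta>_def)
  have "L * \<eta> \<le> r / 8"
    using assms(3) L by (simp add: \<eta>_def field_simps)
  have "\<forall>\<^sub>F k in sequentially. 0 \<le> \<tau> k + a \<and>
        (\<forall>s\<in>{p..q}. \<sigma> (\<tau> k + s) = \<sigma> (\<tau> k + p) \<and>
           dist (x (\<tau> k + s), \<sigma> (\<tau> k + s)) (y t, \<gamma>) < r)"
    if pq: "a < p" "p < q" "q < b" "\<bar>p - t\<bar> < \<eta>" "\<bar>q - t\<bar> < \<eta>" for p q
  proof -
    \<comment> \<open>Constancy is available on open intervals, so the window is widened slightly to
      include its ends.\<close>
    obtain p' q' where p': "a < p'" "p' < p" and q': "q < q'" "q' < b" using pq dense by meson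
    have "(\<lambda>k. x (\<tau> k + p)) \<longlonglongrightarrow> y p" "(\<lambda>k. \<sigma> (\<tau> k + p)) \<longlonglongrightarrow> \<gamma>"
      using D(3,4)[of p] pq by auto
    then have "\<forall>\<^sub>F k in sequentially. dist (x (\<tau> k + p)) (y p) < r / 4"
      "\<forall>\<^sub>F k in sequentially. dist (\<sigma> (\<tau> k + p)) \<gamma> < r / 4"
      using tendstoD[of _ _ _ "r / 4"] assms(3) by (simp_all del: less_divide_eq_numeral1)
    moreover have "\<forall>\<^sub>F k in sequentially. 0 \<le> \<tau> k + a" by (rule D(2)) simp
    moreover have "\<forall>\<^sub>F k in sequentially. \<sigma> constant_on {\<tau> k + p'<..<\<tau> k + q'}"
      using p' q' pq by (intro D(5)) auto
    ultimately show ?thesis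
    proof eventually_elim
      case (elim k)
      have "\<sigma> (\<tau> k + s) = \<sigma> (\<tau> k + p) \<and> dist (x (\<tau> k + s), \<sigma> (\<tau> k + s)) (y t, \<gamma>) < r"
        if s: "s \<in> {p..q}" for s
      proof
        show eq: "\<sigma> (\<tau> k + s) = \<sigma> (\<tau> k + p)"
          using elim(4) p' q' s pq unfolding constant_on_def by force
        have "dist (x (\<tau> k + s)) (x (\<tau> k + p)) \<le> L * \<bar>s - p\<bar>"
          using lipschitz_onD[OF L(2), of "\<tau> k + s" "\<tau> k + p"] elim s pq by (simp add: dist_real_def)
        also have "\<dots> \<le> L * (2 * \<eta>)" using s pq L by (intro mult_left_mono) auto
        finally have 1: "dist (x (\<tau> k + s)) (x (\<tau> k + p)) \<le> r / 4" using \<open>L * \<eta> \<le> r / 8\<close> by simp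
        have "dist (y p) (y t) \<le> L * \<bar>p - t\<bar>"
          using lipschitz_onD[OF yL, of p t] pq assms(2) by (simp add: dist_real_def)
        also have "\<dots> \<le> L * \<eta>" using pq L by (intro mult_left_mono) auto
        finally have 2: "dist (y p) (y t) \<le> r / 8" using \<open>L * \<eta> \<le> r / 8\<close> by simp
        have "dist (x (\<tau> k + s)) (y t) \<le> dist (x (\<tau> k + s)) (x (\<tau> k + p)) + dist (x (\<tau> k + p)) (y p) + dist (y p) (y t)"
          using dist_triangle[of "x (\<tau> k + s)" "y t" "x (\<tau> k + p)"] dist_triangle[of "x (\<tau> k + p)" "y t" "y p"] by linarith
        then have "dist (x (\<tau> k + s)) (y t) < r / 4 + r / 4 + r / 8" using 1 2 elim(1) by linarith
        moreover have "dist (\<sigma> (\<tau> k + s)) \<gamma> < r / 4" using elim(2) eq by simp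
        moreover have "dist (x (\<tau> k + s), \<sigma> (\<tau> k + s)) (y t, \<gamma>)
            \<le> dist (x (\<tau> k + s)) (y t) + dist (\<sigma> (\<tau> k + s)) \<gamma>"
          unfolding dist_Pair_Pair using sqrt_sum_squares_le_sum by simp
        ultimately show "dist (x (\<tau> k + s), \<sigma> (\<tau> k + s)) (y t, \<gamma>) < r" using assms(3) by linarith
      qed
      then show ?case using elim(3) by blast
    qed
  qed
  then show thesis using that[OF \<open>\<eta> > 0\<close>] by blast
qed

text \<open>By continuity the right-hand side along late translates is \<open>e\<close>-close to
  \<open>f (y t, \<gamma>)\<close> near \<open>t\<close>. So \<open>mean_estimate\<close> applies
  with this frozen vector, and the resulting bound on increments passes to \<open>y\<close>. The
  derivative exists at every time of the closed interval, not just almost everywhere.\<close>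

lemma limit_arc_derivative:
  assumes "limit_arc \<tau> y a b \<gamma>" "t \<in> {a..b}"
  shows "(y has_vector_derivative f (y t, \<gamma>)) (at t within {a..b})"
proof (rule has_vector_derivative_within_Icc_from_interior)
  note D = limit_arcD[OF assms(1)]
  show "a < b" "continuous_on {a..b} y" "t \<in> {a..b}"
    using D(1) limit_arc_continuous[OF assms(1)] assms(2) by auto
  fix e :: real assume "e > 0"
  let ?c = "f (y t, \<gamma>)"
  obtain r where "r > 0" and r: "\<And>z. z \<in> domf \<Longrightarrow> dist z (y t, \<gamma>) < r \<Longrightarrow> dist (f z) ?c < e"
    using continuous_f limit_arc_domf[OF assms] \<open>e > 0\<close> unfolding continuous_on_iff by meson
  obtain \<eta> where "0 < \<eta>" and \<eta>:
    "\<And>p q. a < p \<Longrightarrow> p < q \<Longrightarrow> q < b \<Longrightarrow> \<bar>p - t\<bar> < \<eta> \<Longrightarrow> \<bar>q - t\<bar> < \<eta> \<Longrightarrow>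
      \<forall>\<^sub>F k in sequentially. 0 \<le> \<tau> k + a \<and>
        (\<forall>s\<in>{p..q}. \<sigma> (\<tau> k + s) = \<sigma> (\<tau> k + p) \<and>
           dist (x (\<tau> k + s), \<sigma> (\<tau> k + s)) (y t, \<gamma>) < r)"
    using limit_arc_near[OF assms \<open>r > 0\<close>] by blast
  have "norm (y q - y p - (q - p) *\<^sub>R ?c) \<le> e * (q - p)"
    if pq: "a < p" "p < q" "q < b" "\<bar>p - t\<bar> < \<eta>" "\<bar>q - t\<bar> < \<eta>" for p q
  proof -
    have "(\<lambda>k. norm (x (\<tau> k + q) - x (\<tau> k + p) - (q - p) *\<^sub>R ?c)) \<longlonglongrightarrow> norm (y q - y p - (q - p) *\<^sub>R ?c)"
      using pq by (intro tendsto_intros D(3)) auto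
    moreover have "\<forall>\<^sub>F k in sequentially. norm (x (\<tau> k + q) - x (\<tau> k + p) - (q - p) *\<^sub>R ?c) \<le> e * (q - p)"
      using \<eta>[OF pq]
    proof eventually_elim
      case (elim k)
      have "norm (f (x s, \<sigma> s) - ?c) \<le> e" if s: "s \<in> {\<tau> k + p<..<\<tau> k + q}" for s
      proof -
        have "s - \<tau> k \<in> {p..q}" "0 \<le> s" using s elim pq by auto
        then have "dist (x (\<tau> k + (s - \<tau> k)), \<sigma> (\<tau> k + (s - \<tau> k))) (y t, \<gamma>) < r"
          using elim by blast
        then have "dist (x s, \<sigma> s) (y t, \<gamma>) < r" by simp
        then show ?thesis using r[OF x_\<sigma>_in[OF \<open>0 \<le> s\<close>]] by (simp add: dist_norm less_imp_le)
      qed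
      then show ?case
        using mean_estimate[of "\<tau> k + p" "\<tau> k + q" e ?c] elim pq \<open>e > 0\<close> by simp
    qed
    ultimately show ?thesis by (intro tendsto_upperbound) auto
  qed
  then show "\<exists>\<eta>>0. \<forall>p q. a < p \<and> p < q \<and> q < b \<and> \<bar>p - t\<bar> < \<eta> \<and> \<bar>q - t\<bar> < \<eta> \<longrightarrow>
      norm (y q - y p - (q - p) *\<^sub>R ?c) \<le> e * (q - p)"
    using \<open>0 < \<eta>\<close> by blast
qed

text \<open>The parameter \<open>U\<close> is the whole space when uniqueness of the zero solution
  is applied, and the projection of the domain of V when the observability-like sets are.\<close>

lemma limit_arc_solution:
  assumes arc: "limit_arc \<tau> y a b \<gamma>" and U: "B \<subseteq> U"
  shows "is_autonomous_solution (U \<inter> fiber domf \<gamma>) (\<lambda>\<xi>. f (\<xi>, \<gamma>)) {a..b} y"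
proof -
  obtain L where L: "L-lipschitz_on {0..} x" using x_lipschitz by blast
  show ?thesis
  proof (rule is_autonomous_solutionI_lipschitz[OF _ _ limit_arc_lipschitz[OF arc L]])
    show "{a..b} \<noteq> {}" using limit_arcD(1)[OF arc] by simp
    show "y t \<in> U \<inter> fiber domf \<gamma>" if "t \<in> {a..b}" for t
      using limit_arc_in[OF arc that] limit_arc_domf[OF arc that] U by (auto simp: fiber_def)
  qed (use limit_arc_derivative[OF arc] in \<open>auto simp: is_interval_cc\<close>)
qed

lemma limit_arc_self:
  assumes "0 \<le> a" "a < b" and "\<And>s. s \<in> {a<..<b} \<Longrightarrow> \<sigma> s = \<gamma>"
  shows "limit_arc (\<lambda>_. 0) x a b \<gamma>"
  unfolding limit_arc_def constant_on_def using assms by auto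

end

subsection \<open>Extraction of convergent translates\<close>

text \<open>\<open>C p q\<close> stands for the eventual number of jumps of the translates between
  \<open>p\<close> and \<open>q\<close>. Among the rational gaps that enclose \<open>t\<close> and
  have ends in fixed bounds \<open>u\<close> and \<open>v\<close>, choose one with the most jumps
  outside it; their number is at most \<open>C u v\<close>, so a maximum exists. A window with a
  jump between an end of this gap and \<open>t\<close> would allow a smaller gap with more jumps
  outside. Hence only jumps that converge to \<open>t\<close> are left.\<close>

lemma superadditive_zero_near:
  fixes C :: "rat \<Rightarrow> rat \<Rightarrow> nat" and t :: real
  assumes mono: "\<And>p p' q' q. p \<le> p' \<Longrightarrow> q' \<le> q \<Longrightarrow> C p' q' \<le> C p q"
    and superadd: "\<And>p q r. p \<le> q \<Longrightarrow> q \<le> r \<Longrightarrow> C p q + C q r \<le> C p r"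
  obtains d where "0 < d"
    "\<And>p q. t - d < of_rat p \<Longrightarrow> p \<le> q \<Longrightarrow> of_rat q < t \<Longrightarrow> C p q = 0"
    "\<And>p q. t < of_rat p \<Longrightarrow> p \<le> q \<Longrightarrow> of_rat q < t + d \<Longrightarrow> C p q = 0"
proof -
  obtain u where u: "of_rat u < t" using of_rat_dense[of "t - 1" t] by auto
  obtain v where v: "t < of_rat v" using of_rat_dense[of t "t + 1"] by auto
  define P where "P z \<longleftrightarrow> u \<le> fst z \<and> of_rat (fst z) < t \<and> t < of_rat (snd z) \<and> snd z \<le> v" for z
  define m where "m z = C u (fst z) + C (snd z) v" for z
  have le: "m z \<le> C u v" if "P z" for z
  proof -
    have "(of_rat (fst z) :: real) < of_rat (snd z)" using that unfolding P_def by linarith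
    then have "fst z \<le> snd z" by (simp add: of_rat_less)
    then have "C u (fst z) + C (fst z) v \<le> C u v" "C (snd z) v \<le> C (fst z) v"
      using that superadd[of u "fst z" v] mono[of "fst z" "snd z" v v] unfolding P_def by auto
    then show ?thesis by (simp add: m_def)
  qed
  have "P (u, v)" using u v by (simp add: P_def)
  then have "\<exists>z. P z \<and> (\<forall>z'. P z' \<longrightarrow> m z' \<le> m z)"
    by (rule ex_has_greatest_nat[where b = "Suc (C u v)"]) (simp add: le less_Suc_eq_le)
  then obtain z where z: "P z" "\<And>z'. P z' \<Longrightarrow> m z' \<le> m z" by auto
  obtain q0 p0 where zq: "z = (q0, p0)" by (cases z)
  have z0: "u \<le> q0" "of_rat q0 < t" "t < of_rat p0" "p0 \<le> v" using z(1) zq by (auto simp: P_def)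
  define d where "d = min (t - of_rat q0) (of_rat p0 - t)"
  show thesis
  proof (rule that)
    show "0 < d" using z0 by (simp add: d_def)
    show "C p q = 0" if "t - d < of_rat p" "p \<le> q" "of_rat q < t" for p q
    proof -
      have "(of_rat q0 :: real) < of_rat p" using that by (auto simp: d_def)
      then have "q0 \<le> p" by (simp add: of_rat_less)
      then have "C u q0 + C p q \<le> C u q"
        using superadd[of u q0 q] mono[of q0 p q q] z0 that by linarith
      moreover have "P (q, p0)" using \<open>q0 \<le> p\<close> z0 that by (auto simp: P_def)
      ultimately show ?thesis using z(2)[of "(q, p0)"] by (simp add: m_def zq)
    qed
    show "C p q = 0" if "t < of_rat p" "p \<le> q" "of_rat q < t + d" for p q
    proof -
      have "(of_rat q :: real) < of_rat p0" using that by (auto simp: d_def)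
      then have "q \<le> p0" by (simp add: of_rat_less)
      then have "C p q + C p0 v \<le> C p v"
        using superadd[of p p0 v] mono[of p p q p0] z0 that by linarith
      moreover have "P (q0, p)" using \<open>q \<le> p0\<close> z0 that by (auto simp: P_def)
      ultimately show ?thesis using z(2)[of "(q0, p)"] by (simp add: m_def zq)
    qed
  qed
qed

context bounded_trajectory
begin

lemma constant_between_jumps:
  assumes "jumps \<sigma> \<inter> {a<..<b} = {}" "a \<le> p" "q \<le> b"
  shows "\<sigma> constant_on {p<..<q}"
proof -
  have "\<sigma> constant_on {a<..<b}" using switching_signal assms(1) by (simp add: switching_signal_def)
  then show ?thesis by (rule constant_on_subset) (use assms in auto)
qed

lemma finite_jumps: "finite (jumps \<sigma> \<inter> {a<..<b})"
proof (rule finite_subset)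
  show "finite (jumps \<sigma> \<inter> {a..b})" using switching_signal by (simp add: switching_signal_def)
qed auto

text \<open>The dwell-time condition bounds the number of jumps in a window independently of the
  translate, so along a subsequence the counts on windows with rational ends are eventually
  constant. On each side of a time there is a stretch whose inner windows have count 0; there late
  signals are constant, which produces the two arcs.\<close>

lemma limit_arcs_exist:
  assumes \<sigma>: "\<sigma> \<in> avg_dwell_signals \<Gamma>" and \<tau>: "filterlim \<tau> at_top sequentially"
  obtains r y where "strict_mono (r :: nat \<Rightarrow> nat)" "\<And>t. (\<lambda>k. x (\<tau> (r k) + t)) \<longlonglongrightarrow> y t"
    "\<And>t. \<exists>d>0. \<exists>\<gamma> \<gamma>'. limit_arc (\<lambda>k. \<tau> (r k) + t) (\<lambda>s. y (t + s)) (-d) 0 \<gamma> \<and>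
        limit_arc (\<lambda>k. \<tau> (r k) + t) (\<lambda>s. y (t + s)) 0 d \<gamma>'"
proof -
  obtain \<tau>D N0 where dw: "\<tau>D > 0"
    "\<And>a b. a < b \<Longrightarrow> real (card (jumps \<sigma> \<inter> {a<..<b})) \<le> real N0 + (b - a) / \<tau>D"
    using \<sigma> by (auto simp: avg_dwell_signals_def avg_dwell_def)
  define cnt where "cnt a b = card (jumps \<sigma> \<inter> {a<..<b})" for a b
  have cnt_mono: "cnt a' b' \<le> cnt a b" if "a \<le> a'" "b' \<le> b" for a a' b b'
    unfolding cnt_def by (rule card_mono[OF finite_jumps]) (use that in auto)
  have cnt_add: "cnt a b + cnt b c \<le> cnt a c" if "a \<le> b" "b \<le> c" for a b c
  proof -
    have "cnt a b + cnt b c = card ((jumps \<sigma> \<inter> {a<..<b}) \<union> (jumps \<sigma> \<inter> {b<..<c}))"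
      unfolding cnt_def by (rule card_Un_disjoint[symmetric]) (auto simp: finite_jumps)
    also have "\<dots> \<le> cnt a c"
      unfolding cnt_def by (rule card_mono[OF finite_jumps]) (use that in auto)
    finally show ?thesis .
  qed
  \<comment> \<open>The absolute value keeps the bound nonnegative for \<open>q \<le> p\<close> as
    well, where the window is empty and the count is 0.\<close>
  define M where "M p q = real N0 + \<bar>of_rat q - of_rat p\<bar> / \<tau>D" for p q :: rat
  have cnt_M: "real (cnt (u + of_rat p) (u + of_rat q)) \<in> {0..M p q}" for u p q
  proof (cases "p < q")
    case True
    then have "u + of_rat p < u + (of_rat q :: real)" by (simp add: of_rat_less)
    from dw(2)[OF this] this show ?thesis by (simp add: cnt_def M_def)
  next
    case False
    then have "{u + of_rat p<..<u + (of_rat q :: real)} = {}" by (simp add: of_rat_less_eq)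
    then show ?thesis using dw(1) by (simp add: cnt_def M_def)
  qed
  obtain r1 c where r1: "strict_mono (r1 :: nat \<Rightarrow> nat)" and
    c: "\<And>pq. (\<lambda>n. real (cnt (\<tau> (r1 n) + of_rat (fst pq)) (\<tau> (r1 n) + of_rat (snd pq)))) \<longlonglongrightarrow> c pq"
    by (rule diagonal_subsequence[of "\<lambda>pq. {0..M (fst pq) (snd pq)}"
          "\<lambda>n pq. real (cnt (\<tau> n + of_rat (fst pq)) (\<tau> n + of_rat (snd pq)))"])
      (use cnt_M in auto)
  obtain r2 g where r2: "strict_mono (r2 :: nat \<Rightarrow> nat)" and
    g: "\<And>p. (\<lambda>n. \<sigma> (\<tau> (r1 (r2 n)) + of_rat p)) \<longlonglongrightarrow> g p"
    by (rule diagonal_subsequence[of "\<lambda>_. \<Gamma>" "\<lambda>n (p::rat). \<sigma> (\<tau> (r1 n) + of_rat p)"])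
      (use compact_\<Gamma> \<sigma>_in in auto)
  \<comment> \<open>Early translates may reach negative times, possibly outside \<open>J\<close>.
    Truncation by \<open>max 0\<close> keeps every term in \<open>B\<close> and changes nothing for
    large \<open>n\<close>.\<close>
  obtain r3 w where r3: "strict_mono (r3 :: nat \<Rightarrow> nat)" and
    w: "\<And>p. (\<lambda>n. x (max 0 (\<tau> (r1 (r2 (r3 n))) + of_rat p))) \<longlonglongrightarrow> w p"
    by (rule diagonal_subsequence[of "\<lambda>_. B" "\<lambda>n (p::rat). x (max 0 (\<tau> (r1 (r2 n)) + of_rat p))"])
      (use compact_B x_in in auto)
  define r where "r = r1 \<circ> r2 \<circ> r3"
  have r: "strict_mono r" unfolding r_def using r1 r2 r3 by (intro strict_mono_o)
  define T where "T k = \<tau> (r k)" for k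
  have T_top: "filterlim T at_top sequentially"
    unfolding T_def by (rule filterlim_compose[OF \<tau> filterlim_subseq[OF r]])
  have T_ge: "\<forall>\<^sub>F k in sequentially. 0 \<le> T k + t" for t
  proof -
    have "\<forall>\<^sub>F k in sequentially. - t \<le> T k" using T_top by (simp add: filterlim_at_top)
    then show ?thesis by eventually_elim linarith
  qed
  have c: "(\<lambda>k. real (cnt (T k + of_rat p) (T k + of_rat q))) \<longlonglongrightarrow> c (p, q)" for p q
    using LIMSEQ_subseq_LIMSEQ[OF c[of "(p, q)"] strict_mono_o[OF r2 r3]] by (simp add: o_def T_def r_def)
  have g: "(\<lambda>k. \<sigma> (T k + of_rat p)) \<longlonglongrightarrow> g p" for p
    using LIMSEQ_subseq_LIMSEQ[OF g[of p] r3] by (simp add: o_def T_def r_def)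
  have w: "(\<lambda>k. x (max 0 (T k + of_rat p))) \<longlonglongrightarrow> w p" for p
    using w[of p] by (simp add: o_def T_def r_def)
  obtain L where L: "0 \<le> L" "L-lipschitz_on {0..} x" using x_lipschitz by blast
  \<comment> \<open>Convergence at rational shifts extends to real ones because the states are
    Lipschitz in the shift, uniformly in \<open>k\<close>.\<close>
  have conv: "convergent (\<lambda>k. x (max 0 (T k + t)))" for t
    unfolding Cauchy_convergent_iff[symmetric]
  proof (rule metric_CauchyI)
    fix e :: real assume "e > 0"
    define h where "h = e / (4 * (L + 1))"
    have "h > 0" using \<open>e > 0\<close> L(1) by (simp add: h_def)
    obtain p :: rat where p: "t < of_rat p" "of_rat p < t + h" using of_rat_dense[of t "t + h"] \<open>h > 0\<close> by auto
    have near: "dist (x (max 0 (T k + t))) (x (max 0 (T k + of_rat p))) \<le> e / 4" for k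
    proof -
      have "dist (x (max 0 (T k + t))) (x (max 0 (T k + of_rat p)))
          \<le> L * dist (max 0 (T k + t)) (max 0 (T k + of_rat p))"
        by (rule lipschitz_onD[OF L(2)]) auto
      also have "\<dots> \<le> L * h" using p L(1) by (intro mult_left_mono) (auto simp: dist_real_def)
      also have "\<dots> \<le> e / 4" using \<open>e > 0\<close> L(1) by (simp add: h_def field_simps)
      finally show ?thesis .
    qed
    have "Cauchy (\<lambda>k. x (max 0 (T k + of_rat p)))" using w by (rule LIMSEQ_imp_Cauchy)
    then obtain K where K: "\<And>m n. m \<ge> K \<Longrightarrow> n \<ge> K \<Longrightarrow>
        dist (x (max 0 (T m + of_rat p))) (x (max 0 (T n + of_rat p))) < e / 2"
      using \<open>e > 0\<close> by (meson metric_CauchyD half_gt_zero)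
    have "dist (x (max 0 (T m + t))) (x (max 0 (T n + t))) < e" if "m \<ge> K" "n \<ge> K" for m n
      using near[of m] near[of n] K[OF that]
        dist_triangle[of "x (max 0 (T m + t))" "x (max 0 (T n + t))" "x (max 0 (T m + of_rat p))"]
        dist_triangle[of "x (max 0 (T m + of_rat p))" "x (max 0 (T n + t))" "x (max 0 (T n + of_rat p))"]
        dist_commute[of "x (max 0 (T n + of_rat p))" "x (max 0 (T n + t))"]
      by linarith
    then show "\<exists>K. \<forall>m\<ge>K. \<forall>n\<ge>K. dist (x (max 0 (T m + t))) (x (max 0 (T n + t))) < e" by blast
  qed
  define y where "y t = lim (\<lambda>k. x (max 0 (T k + t)))" for t
  have y: "(\<lambda>k. x (T k + t)) \<longlonglongrightarrow> y t" for t
  proof (rule Lim_transform_eventually)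
    show "(\<lambda>k. x (max 0 (T k + t))) \<longlonglongrightarrow> y t"
      using conv unfolding y_def by (simp add: convergent_LIMSEQ_iff)
    show "\<forall>\<^sub>F k in sequentially. x (max 0 (T k + t)) = x (T k + t)"
      using T_ge[of t] by eventually_elim simp
  qed
  \<comment> \<open>A convergent sequence of integers is eventually equal to its limit, so the floor
    loses nothing.\<close>
  define C where "C p q = nat \<lfloor>c (p, q)\<rfloor>" for p q
  have cC: "\<forall>\<^sub>F k in sequentially. cnt (T k + of_rat p) (T k + of_rat q) = C p q" for p q
  proof -
    have "\<exists>K. \<forall>k\<ge>K. dist (real (cnt (T k + of_rat p) (T k + of_rat q))) (c (p, q)) < 1/2"
      by (rule metric_LIMSEQ_D[OF c]) simp
    then obtain K where
      K: "\<And>k. k \<ge> K \<Longrightarrow> dist (real (cnt (T k + of_rat p) (T k + of_rat q))) (c (p, q)) < 1/2" by blast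
    have const: "cnt (T k + of_rat p) (T k + of_rat q) = cnt (T K + of_rat p) (T K + of_rat q)" if "k \<ge> K" for k
    proof -
      have "\<bar>real (cnt (T k + of_rat p) (T k + of_rat q)) - real (cnt (T K + of_rat p) (T K + of_rat q))\<bar> < 1"
        using K[OF that] K[of K] unfolding dist_real_def by linarith
      then show ?thesis by linarith
    qed
    define n where "n = cnt (T K + of_rat p) (T K + of_rat q)"
    have ev: "\<forall>\<^sub>F k in sequentially. cnt (T k + of_rat p) (T k + of_rat q) = n"
      unfolding n_def by (rule eventually_mono[OF eventually_ge_at_top[of K] const])
    then have "(\<lambda>k. real (cnt (T k + of_rat p) (T k + of_rat q))) \<longlonglongrightarrow> real n"
      by (intro tendsto_eventually) (auto elim: eventually_mono)
    then have "c (p, q) = real n" using c LIMSEQ_unique by blast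
    then show ?thesis using ev by (simp add: C_def)
  qed
  have C_mono: "C p' q' \<le> C p q" if pq: "p \<le> p'" "q' \<le> q" for p p' q' q
  proof -
    have "\<forall>\<^sub>F k in sequentially. C p' q' \<le> C p q"
      using cC[of p' q'] cC[of p q]
    proof eventually_elim
      case (elim k)
      then show ?case using cnt_mono[of "T k + of_rat p" "T k + of_rat p'" "T k + of_rat q'" "T k + of_rat q"] pq
        by (simp add: of_rat_less_eq)
    qed
    then show ?thesis by simp
  qed
  have C_add: "C p q + C q s \<le> C p s" if pq: "p \<le> q" "q \<le> s" for p q s
  proof -
    have "\<forall>\<^sub>F k in sequentially. C p q + C q s \<le> C p s"
      using cC[of p q] cC[of q s] cC[of p s]
    proof eventually_elim
      case (elim k)
      then show ?case using cnt_add[of "T k + of_rat p" "T k + of_rat q" "T k + of_rat s"] pq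
        by (simp add: of_rat_less_eq)
    qed
    then show ?thesis by simp
  qed
  have arc: "\<exists>\<gamma>. limit_arc (\<lambda>k. T k + t) (\<lambda>s. y (t + s)) a b \<gamma>"
    if "a < b" and zero: "\<And>p q. t + a < of_rat p \<Longrightarrow> p \<le> q \<Longrightarrow> of_rat q < t + b \<Longrightarrow> C p q = 0" for a b t
  proof -
    have const: "\<forall>\<^sub>F k in sequentially. \<sigma> constant_on {T k + t + p<..<T k + t + q}"
      if pq: "a < p" "p < q" "q < b" for p q
    proof -
      obtain p' where p': "t + a < of_rat p'" "of_rat p' < t + p" using of_rat_dense[of "t + a" "t + p"] pq by auto
      obtain q' where q': "t + q < of_rat q'" "of_rat q' < t + b" using of_rat_dense[of "t + q" "t + b"] pq by auto
      have "(of_rat p' :: real) < of_rat q'" using p' q' pq by linarith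
      then have "C p' q' = 0" using zero p' q' by (simp add: of_rat_less)
      then have "\<forall>\<^sub>F k in sequentially. cnt (T k + of_rat p') (T k + of_rat q') = 0" using cC[of p' q'] by simp
      then show ?thesis
      proof eventually_elim
        case (elim k)
        then have "jumps \<sigma> \<inter> {T k + of_rat p'<..<T k + of_rat q'} = {}"
          using finite_jumps by (simp add: cnt_def)
        then show ?case by (rule constant_between_jumps) (use p' q' in auto)
      qed
    qed
    \<comment> \<open>One rational time inside the arc fixes its index: every other interior time
      shares with it a window on which late signals are constant.\<close>
    obtain m where m: "t + a < of_rat m" "of_rat m < t + b" using of_rat_dense[of "t + a" "t + b"] \<open>a < b\<close> by auto
    have "(\<lambda>k. \<sigma> (T k + t + s)) \<longlonglongrightarrow> g m" if s: "s \<in> {a<..<b}" for s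
    proof (rule Lim_transform_eventually[OF g])
      obtain p where p: "a < p" "p < min s (of_rat m - t)" using dense[of a "min s (of_rat m - t)"] s m by auto
      obtain q where q: "max s (of_rat m - t) < q" "q < b" using dense[of "max s (of_rat m - t)" b] s m by auto
      have "\<forall>\<^sub>F k in sequentially. \<sigma> constant_on {T k + t + p<..<T k + t + q}"
        using p q by (intro const) auto
      then show "\<forall>\<^sub>F k in sequentially. \<sigma> (T k + of_rat m) = \<sigma> (T k + t + s)"
      proof eventually_elim
        case (elim k)
        moreover have "T k + of_rat m \<in> {T k + t + p<..<T k + t + q}" "T k + t + s \<in> {T k + t + p<..<T k + t + q}"
          using p q by auto
        ultimately show ?case unfolding constant_on_def by metis
      qed
    qed
    moreover have "(\<lambda>k. x (T k + t + s)) \<longlonglongrightarrow> y (t + s)" for s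
      using y[of "t + s"] by (simp add: add.assoc)
    ultimately have "limit_arc (\<lambda>k. T k + t) (\<lambda>s. y (t + s)) a b (g m)"
      unfolding limit_arc_def using \<open>a < b\<close> const T_ge[of "t + a"] by (simp add: add.assoc)
    then show ?thesis by blast
  qed
  have "\<exists>d>0. \<exists>\<gamma> \<gamma>'. limit_arc (\<lambda>k. T k + t) (\<lambda>s. y (t + s)) (-d) 0 \<gamma> \<and>
      limit_arc (\<lambda>k. T k + t) (\<lambda>s. y (t + s)) 0 d \<gamma>'" for t
  proof -
    obtain d where "0 < d"
      "\<And>p q. t - d < of_rat p \<Longrightarrow> p \<le> q \<Longrightarrow> of_rat q < t \<Longrightarrow> C p q = 0"
      "\<And>p q. t < of_rat p \<Longrightarrow> p \<le> q \<Longrightarrow> of_rat q < t + d \<Longrightarrow> C p q = 0"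
      by (rule superadditive_zero_near[of C t, OF C_mono C_add]) auto
    then show ?thesis using arc[of "-d" 0 t] arc[of 0 d t] by auto
  qed
  then show thesis using that[OF r, of y] y unfolding T_def by blast
qed

end

subsection \<open>The invariance argument\<close>

lemma has_vector_derivative_within_Un:
  assumes "(y has_vector_derivative c) (at t within S)" "(y has_vector_derivative c) (at t within T)"
  shows "(y has_vector_derivative c) (at t within S \<union> T)"
  using assms unfolding has_vector_derivative_def has_derivative_within by (auto intro: Lim_Un)

lemma filterlim_shift:
  fixes \<tau> :: "nat \<Rightarrow> real"
  assumes "filterlim \<tau> at_top sequentially"
  shows "filterlim (\<lambda>k. \<tau> k + s) at_top sequentially"
  using assms by (simp add: filterlim_tendsto_add_at_top[OF tendsto_const] add.commute)

lemma zeroing_setI: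
  assumes "is_autonomous_solution X g J \<phi>" "0 \<in> J" "\<phi> 0 = \<xi>" "\<And>t. t \<in> J \<Longrightarrow> h (\<phi> t) = 0"
  shows "\<xi> \<in> zeroing_set J X g h"
proof -
  have "\<xi> \<in> X" using assms by (auto simp: is_solution_def)
  then show ?thesis using assms by (auto simp: zeroing_set_def)
qed

context bounded_trajectory
begin

text \<open>The part of the argument common to all three sets of hypotheses, with V hidden behind
  the assumption on limit arcs. \<open>Q\<close> is what else is known on every arc: nothing in the
  case of (ii), a common level of V in the case of (ii').\<close>

lemma tendsto_zero_if_limit_arcs_vanish:
  assumes \<sigma>: "\<sigma> \<in> avg_dwell_signals \<Gamma>" and U: "B \<subseteq> U"
    and uniq: "\<And>\<gamma>. \<gamma> \<in> \<Gamma> \<Longrightarrow> 0 \<in> fiber domf \<gamma> \<Longrightarrow> unique_zero_solution (fiber domf \<gamma>) (\<lambda>\<xi>. f (\<xi>, \<gamma>))"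
    and W: "\<And>\<tau> y a b \<gamma> s. filterlim \<tau> at_top sequentially \<Longrightarrow> limit_arc \<tau> y a b \<gamma> \<Longrightarrow>
        s \<in> {a..b} \<Longrightarrow> W \<gamma> (y s) = 0 \<and> Q \<gamma> (y s)"
    and i: "\<And>\<gamma>. \<gamma> \<in> \<Gamma> \<Longrightarrow> fwd_inf (U \<inter> fiber domf \<gamma>) (\<lambda>\<xi>. f (\<xi>, \<gamma>)) (W \<gamma>) \<inter>
        bwd_inf (U \<inter> fiber domf \<gamma>) (\<lambda>\<xi>. f (\<xi>, \<gamma>)) (W \<gamma>) \<subseteq> {0}"
    and ii: "\<And>\<gamma> \<gamma>' \<xi>. \<gamma> \<in> \<Gamma> \<Longrightarrow> \<gamma>' \<in> \<Gamma> \<Longrightarrow> \<gamma> \<noteq> \<gamma>' \<Longrightarrow>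
        \<xi> \<in> bwd (U \<inter> fiber domf \<gamma>) (\<lambda>\<xi>. f (\<xi>, \<gamma>)) (W \<gamma>) \<Longrightarrow>
        \<xi> \<in> fwd (U \<inter> fiber domf \<gamma>') (\<lambda>\<xi>. f (\<xi>, \<gamma>')) (W \<gamma>') \<Longrightarrow> Q \<gamma> \<xi> \<Longrightarrow> Q \<gamma>' \<xi> \<Longrightarrow> \<xi> = 0"
  shows "(x \<longlongrightarrow> 0) at_top"
proof (rule ccontr)
  assume "\<not> (x \<longlongrightarrow> 0) at_top"
  then obtain e where "e > 0" and e: "\<forall>N. \<exists>t\<ge>N. e \<le> norm (x t)"
    by (auto simp: tendsto_iff eventually_at_top_linorder not_less)
  define \<tau> where "\<tau> k = (SOME t. real k \<le> t \<and> e \<le> norm (x t))" for k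
  have \<tau>: "real k \<le> \<tau> k \<and> e \<le> norm (x (\<tau> k))" for k
    unfolding \<tau>_def by (rule someI_ex) (use e in auto)
  have "filterlim \<tau> at_top sequentially"
    by (rule filterlim_at_top_mono[OF filterlim_real_sequentially]) (use \<tau> in auto)
  then obtain r y where r: "strict_mono (r :: nat \<Rightarrow> nat)" and
    y: "\<And>t. (\<lambda>k. x (\<tau> (r k) + t)) \<longlonglongrightarrow> y t" and
    arcs: "\<And>t. \<exists>d>0. \<exists>\<gamma> \<gamma>'. limit_arc (\<lambda>k. \<tau> (r k) + t) (\<lambda>s. y (t + s)) (-d) 0 \<gamma> \<and>
        limit_arc (\<lambda>k. \<tau> (r k) + t) (\<lambda>s. y (t + s)) 0 d \<gamma>'"
    using limit_arcs_exist[OF \<sigma>] by metis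
  define T where "T k = \<tau> (r k)" for k
  note y = y[folded T_def] and arcs = arcs[folded T_def]
  have T_top: "filterlim T at_top sequentially"
    unfolding T_def using \<open>filterlim \<tau> at_top sequentially\<close> filterlim_subseq[OF r] by (rule filterlim_compose)
  have T_shift: "filterlim (\<lambda>k. T k + t) at_top sequentially" for t
    using T_top by (rule filterlim_shift)
  have T_ge: "\<forall>\<^sub>F k in sequentially. 0 \<le> T k + t" for t
    using T_shift[of t] by (simp add: filterlim_at_top)
  obtain L where L: "L-lipschitz_on {0..} x" using x_lipschitz by blast
  have yL: "L-lipschitz_on S y" for S by (rule limit_lipschitz[OF T_ge y L])
  then have ycont: "isCont y t" for t
    using lipschitz_on_continuous_on[of L UNIV y] by (simp add: continuous_on_eq_continuous_at)
  have "norm (y 0) \<ge> e"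
  proof (rule LIMSEQ_le_const)
    show "(\<lambda>k. norm (x (T k + 0))) \<longlonglongrightarrow> norm (y 0)" by (intro tendsto_norm y)
    show "\<exists>N. \<forall>n\<ge>N. e \<le> norm (x (T n + 0))" using \<tau> by (simp add: T_def)
  qed
  then have y0: "y 0 \<noteq> 0" using \<open>e > 0\<close> by auto
  \<comment> \<open>The zero set of \<open>y\<close> is open, since by uniqueness both arcs at a
    zero vanish identically, and closed by continuity. The line is connected and
    \<open>y 0 \<noteq> 0\<close>, so the set is empty.\<close>
  have y_nz: "y t \<noteq> 0" for t
  proof -
    have zero: "y (t + s) = 0"
      if arc: "limit_arc (\<lambda>k. T k + t) (\<lambda>s. y (t + s)) a b \<gamma>" and "0 \<in> {a..b}" "s \<in> {a..b}" "y t = 0"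
      for t s a b \<gamma>
    proof -
      have "is_autonomous_solution (fiber domf \<gamma>) (\<lambda>\<xi>. f (\<xi>, \<gamma>)) {a..b} (\<lambda>s. y (t + s))"
        using limit_arc_solution[OF arc, of UNIV] by simp
      moreover have "0 \<in> fiber domf \<gamma>"
        using limit_arc_domf[OF arc \<open>0 \<in> {a..b}\<close>] \<open>y t = 0\<close> by (simp add: fiber_def)
      then have "unique_zero_solution (fiber domf \<gamma>) (\<lambda>\<xi>. f (\<xi>, \<gamma>))"
        using limit_arcD(6)[OF arc] by (intro uniq)
      ultimately show ?thesis
        using that(2-4) unfolding unique_zero_solution_def by (metis add.right_neutral)
    qed
    have "\<forall>\<^sub>F s in at t within UNIV. (y t = 0) = (y s = 0)" for t
    proof (cases "y t = 0")
      case True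
      obtain d \<gamma> \<gamma>' where "d > 0" and d: "limit_arc (\<lambda>k. T k + t) (\<lambda>s. y (t + s)) (-d) 0 \<gamma>"
        "limit_arc (\<lambda>k. T k + t) (\<lambda>s. y (t + s)) 0 d \<gamma>'" using arcs by blast
      have "y s = 0" if "dist s t < d" for s
      proof (cases "s \<le> t")
        case True
        then show ?thesis using zero[OF d(1), of "s - t"] that \<open>y t = 0\<close> \<open>d > 0\<close> by (simp add: dist_real_def)
      next
        case False
        then show ?thesis using zero[OF d(2), of "s - t"] that \<open>y t = 0\<close> \<open>d > 0\<close> by (simp add: dist_real_def)
      qed
      then show ?thesis using True \<open>d > 0\<close> by (auto simp: eventually_at intro!: exI[of _ d])
    next
      case False
      then have "\<forall>\<^sub>F s in at t. y s \<noteq> 0"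
        using ycont[of t] by (intro tendsto_imp_eventually_ne) (auto simp: isCont_def)
      then show ?thesis by eventually_elim (use False in simp)
    qed
    then have "(y 0 = 0) = (y t = 0)"
      by (intro connected_local_const[of UNIV 0 t "\<lambda>t. y t = 0"]) auto
    then show ?thesis using y0 by simp
  qed
  have "\<exists>d>0. \<exists>\<gamma>. limit_arc (\<lambda>k. T k + t) (\<lambda>s. y (t + s)) (-d) 0 \<gamma> \<and>
      limit_arc (\<lambda>k. T k + t) (\<lambda>s. y (t + s)) 0 d \<gamma>" for t
  proof -
    obtain d \<gamma> \<gamma>' where "d > 0" and d: "limit_arc (\<lambda>k. T k + t) (\<lambda>s. y (t + s)) (-d) 0 \<gamma>"
      "limit_arc (\<lambda>k. T k + t) (\<lambda>s. y (t + s)) 0 d \<gamma>'" using arcs by blast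
    have "\<gamma> = \<gamma>'"
    proof (rule ccontr)
      assume "\<gamma> \<noteq> \<gamma>'"
      have "y t \<in> zeroing_set {-d..0} (U \<inter> fiber domf \<gamma>) (\<lambda>\<xi>. f (\<xi>, \<gamma>)) (W \<gamma>)"
        by (rule zeroing_setI[OF limit_arc_solution[OF d(1) U]])
          (use W[OF T_shift d(1)] \<open>d > 0\<close> in auto)
      then have "y t \<in> bwd (U \<inter> fiber domf \<gamma>) (\<lambda>\<xi>. f (\<xi>, \<gamma>)) (W \<gamma>)"
        unfolding bwd_def using \<open>d > 0\<close> by blast
      moreover have "y t \<in> zeroing_set {0..d} (U \<inter> fiber domf \<gamma>') (\<lambda>\<xi>. f (\<xi>, \<gamma>')) (W \<gamma>')"
        by (rule zeroing_setI[OF limit_arc_solution[OF d(2) U]])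
          (use W[OF T_shift d(2)] \<open>d > 0\<close> in auto)
      then have "y t \<in> fwd (U \<inter> fiber domf \<gamma>') (\<lambda>\<xi>. f (\<xi>, \<gamma>')) (W \<gamma>')"
        unfolding fwd_def using \<open>d > 0\<close> by blast
      moreover have "Q \<gamma> (y t)" "Q \<gamma>' (y t)"
        using W[OF T_shift d(1), of 0] W[OF T_shift d(2), of 0] \<open>d > 0\<close> by auto
      ultimately have "y t = 0"
        using ii[OF limit_arcD(6)[OF d(1)] limit_arcD(6)[OF d(2)] \<open>\<gamma> \<noteq> \<gamma>'\<close>] by blast
      then show False using y_nz by blast
    qed
    then show ?thesis using d \<open>d > 0\<close> by blast
  qed
  then obtain d G where dG: "\<And>t. d t > 0"
    "\<And>t. limit_arc (\<lambda>k. T k + t) (\<lambda>s. y (t + s)) (- d t) 0 (G t)"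
    "\<And>t. limit_arc (\<lambda>k. T k + t) (\<lambda>s. y (t + s)) 0 (d t) (G t)" by metis
  \<comment> \<open>\<open>w = t\<close> is excluded: where the two arcs meet, the signals need not
    converge.\<close>
  have lim_G: "(\<lambda>k. \<sigma> (T k + w)) \<longlonglongrightarrow> G t" if "\<bar>w - t\<bar> < d t" "w \<noteq> t" for w t
  proof (cases "w < t")
    case True
    then show ?thesis using limit_arcD(4)[OF dG(2)[of t], of "w - t"] that by auto
  next
    case False
    then show ?thesis using limit_arcD(4)[OF dG(3)[of t], of "w - t"] that by auto
  qed
  have "G t = G s" if st: "s \<noteq> t" "dist s t < d t" for s t
  proof -
    \<comment> \<open>A time close to \<open>s\<close>, on the side of \<open>t\<close>, is interior
      to an arc at \<open>s\<close> and to an arc at \<open>t\<close>, and the signals there have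
      only one limit.\<close>
    have "\<exists>w. \<bar>w - s\<bar> < d s \<and> w \<noteq> s \<and> \<bar>w - t\<bar> < d t \<and> w \<noteq> t"
    proof (cases "s < t")
      case True
      then obtain w where "s < w" "w < min t (s + d s)" using dense[of s "min t (s + d s)"] dG(1)[of s] by auto
      then show ?thesis using st by (intro exI[of _ w]) (auto simp: dist_real_def)
    next
      case False
      then obtain w where "max t (s - d s) < w" "w < s"
        using dense[of "max t (s - d s)" s] dG(1)[of s] st(1) by auto
      then show ?thesis using st by (intro exI[of _ w]) (auto simp: dist_real_def)
    qed
    then show ?thesis using lim_G LIMSEQ_unique by blast
  qed
  then have "\<forall>\<^sub>F s in at t within UNIV. G t = G s" for t
    unfolding eventually_at using dG(1)[of t] by blast
  then have "G t = G 0" for t by (intro connected_local_const[of UNIV t 0 G]) auto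
  then obtain \<gamma> where G: "\<And>t. G t = \<gamma>" by blast
  note arc = dG(2)[unfolded G] dG(3)[unfolded G]
  let ?X = "U \<inter> fiber domf \<gamma>"
  have yX: "y t \<in> ?X" and yW: "W \<gamma> (y t) = 0" for t
    using limit_arc_in[OF arc(1)[of t], of 0] limit_arc_domf[OF arc(1)[of t], of 0] U
      W[OF T_shift arc(1)[of t], of 0] dG(1)[of t] by (auto simp: fiber_def)
  \<comment> \<open>As the index is the same on both sides, the one-sided derivatives at
    \<open>t\<close> agree, and \<open>y\<close> solves a single autonomous equation across all
    junctions.\<close>
  have yder: "(y has_vector_derivative f (y t, \<gamma>)) (at t within S)" for t S
  proof -
    let ?z = "\<lambda>s. y (t + s)"
    have "(?z has_vector_derivative f (y t, \<gamma>)) (at 0 within {- d t..0} \<union> {0..d t})"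
      using limit_arc_derivative[OF arc(1)[of t], of 0] limit_arc_derivative[OF arc(2)[of t], of 0] dG(1)[of t]
      by (intro has_vector_derivative_within_Un) auto
    then have "(?z has_vector_derivative f (y t, \<gamma>)) (at 0 within {- d t<..<d t})"
      by (rule has_vector_derivative_within_subset) auto
    then have "(?z has_vector_derivative f (y t, \<gamma>)) (at (t - t))"
      using dG(1)[of t] at_within_open[of 0 "{- d t<..<d t}"] by simp
    then have "((?z \<circ> (\<lambda>u. u - t)) has_vector_derivative 1 *\<^sub>R f (y t, \<gamma>)) (at t)"
      by (intro vector_diff_chain_at) (auto intro!: derivative_eq_intros)
    then have "(y has_vector_derivative f (y t, \<gamma>)) (at t)" by (simp add: o_def)
    then show ?thesis by (rule has_vector_derivative_at_within)
  qed
  have "is_autonomous_solution ?X (\<lambda>\<xi>. f (\<xi>, \<gamma>)) {0..} y" "is_autonomous_solution ?X (\<lambda>\<xi>. f (\<xi>, \<gamma>)) {..0} y"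
    by (rule is_autonomous_solutionI_lipschitz[OF _ _ yL],
        use yX yder in \<open>auto simp: is_interval_ci is_interval_ic\<close>)+
  then have "y 0 \<in> fwd_inf ?X (\<lambda>\<xi>. f (\<xi>, \<gamma>)) (W \<gamma>)" "y 0 \<in> bwd_inf ?X (\<lambda>\<xi>. f (\<xi>, \<gamma>)) (W \<gamma>)"
    unfolding fwd_inf_def bwd_inf_def using yW by (auto intro!: zeroing_setI)
  then show False using i[OF limit_arcD(6)[OF arc(1)]] y0 by blast
qed

end

subsection \<open>Lyapunov functions along limit arcs\<close>

locale lyapunov_trajectory = bounded_trajectory \<Gamma> domf f x \<sigma> J B
  for \<Gamma> :: "'g::metric_space set" and domf :: "('a::euclidean_space \<times> 'g) set"
    and f :: "'a \<times> 'g \<Rightarrow> 'a" and x \<sigma> J B +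
  fixes domV :: "('a \<times> 'g) set" and V :: "'a \<times> 'g \<Rightarrow> real" and W :: "'g \<Rightarrow> 'a \<Rightarrow> real"
  assumes class_V: "class_V \<Gamma> domf domV V"
    and decrease: "decrease_cond \<Gamma> domf f domV V W"
    and B_subset: "B \<subseteq> fst ` domV"
begin

abbreviation v :: "real \<Rightarrow> real" where "v t \<equiv> V (x t, \<sigma> t)"

abbreviation D :: "('a \<times> 'g) set" where "D \<equiv> domf \<inter> (fst ` domV \<times> \<Gamma>)"

lemma decreaseD:
  assumes "(\<xi>, \<gamma>) \<in> D"
  shows "W \<gamma> \<xi> \<le> - (grad (\<lambda>\<zeta>. V (\<zeta>, \<gamma>)) \<xi> \<bullet> f (\<xi>, \<gamma>))" "0 \<le> W \<gamma> \<xi>"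
  using assms decrease by (auto simp: decrease_cond_def sect_def fiber_def)

lemma V_differentiable: "(\<xi>, \<gamma>) \<in> D \<Longrightarrow> (\<lambda>\<zeta>. V (\<zeta>, \<gamma>)) differentiable (at \<xi>)"
  using class_V by (auto simp: class_V_def sect_def fiber_def)

lemma x_\<sigma>_in_D: "0 \<le> t \<Longrightarrow> (x t, \<sigma> t) \<in> D"
  using x_\<sigma>_in x_in \<sigma>_in B_subset by auto

lemma limit_arc_in_D: "limit_arc \<tau> y a b \<gamma> \<Longrightarrow> s \<in> {a..b} \<Longrightarrow> (y s, \<gamma>) \<in> D"
  using limit_arc_domf limit_arc_in limit_arcD(6) B_subset by blast

text \<open>The chain rule for one fixed index. It also covers the trajectory itself between jumps,
  which is an arc for the zero shift.\<close>

lemma limit_arc_V_derivative: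
  assumes arc: "limit_arc \<tau> y a b \<gamma>" and s: "s \<in> {a..b}"
  shows "((\<lambda>s. V (y s, \<gamma>)) has_vector_derivative grad (\<lambda>\<zeta>. V (\<zeta>, \<gamma>)) (y s) \<bullet> f (y s, \<gamma>)) (at s within {a..b})"
proof -
  have "((\<lambda>\<zeta>. V (\<zeta>, \<gamma>)) has_derivative (\<lambda>h. h \<bullet> grad (\<lambda>\<zeta>. V (\<zeta>, \<gamma>)) (y s))) (at (y s))"
    using GDERIV_grad[OF V_differentiable[OF limit_arc_in_D[OF arc s]]] by (simp add: gderiv_def)
  from has_derivative_compose[OF limit_arc_derivative[OF arc s, unfolded has_vector_derivative_def] this]
  show ?thesis by (simp add: has_vector_derivative_def inner_commute)
qed

lemma limit_arc_V_continuous: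
  assumes "limit_arc \<tau> y a b \<gamma>"
  shows "continuous_on {a..b} (\<lambda>s. V (y s, \<gamma>))"
  using limit_arc_V_derivative[OF assms] by (rule continuous_on_vector_derivative)

lemma limit_arc_const_closure:
  fixes h :: "real \<Rightarrow> real"
  assumes arc: "limit_arc \<tau> y a b \<gamma>" and "continuous_on {a..b} h"
    and "\<And>s. s \<in> {a<..<b} \<Longrightarrow> h s = c" and "s \<in> {a..b}"
  shows "h s = c"
proof -
  have "closure {a<..<b} = {a..b}" using limit_arcD(1)[OF arc] by (rule closure_greaterThanLessThan)
  then show ?thesis using continuous_constant_on_closure[of "{a<..<b}" h c s] assms(2-4) by simp
qed

text \<open>At the endpoints \<open>W\<close> is reached through the one-sided derivatives of the solution, as \<open>W\<close> may
  be discontinuous.\<close>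

lemma W_zero_if_V_constant:
  assumes arc: "limit_arc \<tau> y a b \<gamma>" and c: "\<And>s. s \<in> {a<..<b} \<Longrightarrow> V (y s, \<gamma>) = c"
    and s: "s \<in> {a..b}"
  shows "W \<gamma> (y s) = 0 \<and> V (y s, \<gamma>) = c"
proof -
  have const: "V (y u, \<gamma>) = c" if "u \<in> {a..b}" for u
    by (rule limit_arc_const_closure[OF arc limit_arc_V_continuous[OF arc] c that])
  have "((\<lambda>s. V (y s, \<gamma>)) has_vector_derivative 0) (at s within {a..b})"
    by (rule has_vector_derivative_transform[OF s const has_vector_derivative_const])
  then have "grad (\<lambda>\<zeta>. V (\<zeta>, \<gamma>)) (y s) \<bullet> f (y s, \<gamma>) = 0"
    using limit_arc_V_derivative[OF arc s] limit_arcD(1)[OF arc] s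
    by (intro vector_derivative_unique_within_closed_interval[of a b s]) (auto simp: box_real)
  then show ?thesis using decreaseD[OF limit_arc_in_D[OF arc s]] const[OF s] by simp
qed

section \<open>Limits of V and W along late translates\<close>

lemma v_tendsto:
  assumes "antimono_on {0..} v" and "bounded (V ` (domf \<inter> (B \<times> \<Gamma>)))"
    and "filterlim u at_top sequentially"
  shows "(\<lambda>k. v (u k)) \<longlonglongrightarrow> Inf (v ` {0..})"
proof (rule antimono_on_bounded_tendsto[OF assms(1) _ assms(3)])
  have "v ` {0..} \<subseteq> V ` (domf \<inter> (B \<times> \<Gamma>))" using x_\<sigma>_in x_in \<sigma>_in by auto
  then have "bounded (v ` {0..})" using assms(2) by (rule bounded_subset[rotated])
  then show "bdd_below (v ` {0..})" by (rule bounded_imp_bdd_below)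
  show "\<forall>\<^sub>F k in sequentially. u k \<in> {0..}" using assms(3) by (simp add: filterlim_at_top)
qed

lemma domf_B_subset_D: "domf \<inter> (B \<times> \<Gamma>) \<subseteq> D"
  using B_subset by auto

text \<open>Along the translates \<open>v\<close> tends to its infimum and, by joint continuity,
  also to V on the arc. The level depends neither on the arc nor on its index, which is what (ii')
  asks for.\<close>

lemma V_constant_if_continuous:
  assumes V: "continuous_on D V" and v: "antimono_on {0..} v"
    and \<tau>: "filterlim \<tau> at_top sequentially" and arc: "limit_arc \<tau> y a b \<gamma>" and s: "s \<in> {a<..<b}"
  shows "V (y s, \<gamma>) = Inf (v ` {0..})"
proof -
  have "bounded (V ` (domf \<inter> (B \<times> \<Gamma>)))"
    by (intro compact_imp_bounded compact_continuous_image compact_domf_B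
        continuous_on_subset[OF V domf_B_subset_D])
  then have "(\<lambda>k. v (\<tau> k + s)) \<longlonglongrightarrow> Inf (v ` {0..})"
    by (rule v_tendsto[OF v _ filterlim_shift[OF \<tau>]])
  moreover have "(\<lambda>k. v (\<tau> k + s)) \<longlonglongrightarrow> V (y s, \<gamma>)"
  proof (rule continuous_on_tendsto_compose[OF V])
    show "(\<lambda>k. (x (\<tau> k + s), \<sigma> (\<tau> k + s))) \<longlonglongrightarrow> (y s, \<gamma>)"
      using s by (intro tendsto_Pair limit_arcD(3,4)[OF arc]) auto
    show "(y s, \<gamma>) \<in> D" using s by (intro limit_arc_in_D[OF arc]) auto
    have "\<forall>\<^sub>F k in sequentially. 0 \<le> \<tau> k + s" using s by (intro limit_arcD(2)[OF arc]) auto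
    then show "\<forall>\<^sub>F k in sequentially. (x (\<tau> k + s), \<sigma> (\<tau> k + s)) \<in> D"
      by (rule eventually_mono) (rule x_\<sigma>_in_D)
  qed
  ultimately show ?thesis by (rule LIMSEQ_unique[rotated])
qed

text \<open>A finite \<Gamma> is discrete, so signals converging to \<gamma> are eventually equal to
  it. Hence only times with index \<gamma> matter, and continuity in the state, a consequence of
  differentiability, replaces joint continuity. The level may vary with the index.\<close>

lemma V_constant_if_finite:
  assumes fin: "finite \<Gamma>" and v: "antimono_on (\<sigma> -` {\<gamma>} \<inter> {0..}) v"
    and \<tau>: "filterlim \<tau> at_top sequentially" and arc: "limit_arc \<tau> y a b \<gamma>" and s: "s \<in> {a<..<b}"
  shows "V (y s, \<gamma>) = Inf (v ` (\<sigma> -` {\<gamma>} \<inter> {0..}))"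
proof -
  let ?S = "\<sigma> -` {\<gamma>} \<inter> {0..}"
  let ?K = "{\<xi> \<in> B. (\<xi>, \<gamma>) \<in> domf}"
  have \<gamma>: "\<gamma> \<in> \<Gamma>" by (rule limit_arcD(6)[OF arc])
  have "open (- (\<Gamma> - {\<gamma>}))" using fin by (intro open_Compl finite_imp_closed) simp
  moreover have "(\<lambda>k. \<sigma> (\<tau> k + s)) \<longlonglongrightarrow> \<gamma>" by (rule limit_arcD(4)[OF arc s])
  ultimately have "\<forall>\<^sub>F k in sequentially. \<sigma> (\<tau> k + s) \<in> - (\<Gamma> - {\<gamma>})"
    by (intro topological_tendstoD) auto
  then have eq: "\<forall>\<^sub>F k in sequentially. \<sigma> (\<tau> k + s) = \<gamma>"
    by (rule eventually_mono) (use \<sigma>_in in auto)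
  have cont: "isCont (\<lambda>\<zeta>. V (\<zeta>, \<gamma>)) \<xi>" if "(\<xi>, \<gamma>) \<in> D" for \<xi>
    using V_differentiable[OF that] by (rule differentiable_imp_continuous_within)
  have "closed ((\<lambda>\<xi>. (\<xi>, \<gamma>)) -` domf)"
    by (intro closed_vimage closed_domf continuous_intros)
  then have "compact (B \<inter> (\<lambda>\<xi>. (\<xi>, \<gamma>)) -` domf)" by (intro compact_Int_closed compact_B)
  moreover have "B \<inter> (\<lambda>\<xi>. (\<xi>, \<gamma>)) -` domf = ?K" by auto
  ultimately have "compact ?K" by simp
  moreover have "continuous_on ?K (\<lambda>\<zeta>. V (\<zeta>, \<gamma>))"
    using B_subset \<gamma> by (intro continuous_at_imp_continuous_on ballI cont) auto
  ultimately have "bounded ((\<lambda>\<zeta>. V (\<zeta>, \<gamma>)) ` ?K)" by (intro compact_imp_bounded compact_continuous_image)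
  moreover have "v ` ?S \<subseteq> (\<lambda>\<zeta>. V (\<zeta>, \<gamma>)) ` ?K"
  proof
    fix z assume "z \<in> v ` ?S"
    then obtain t where "\<sigma> t = \<gamma>" "0 \<le> t" "z = v t" by auto
    then show "z \<in> (\<lambda>\<zeta>. V (\<zeta>, \<gamma>)) ` ?K" using x_in[of t] x_\<sigma>_in[of t] by auto
  qed
  ultimately have "bdd_below (v ` ?S)" by (intro bounded_imp_bdd_below) (rule bounded_subset)
  moreover have "\<forall>\<^sub>F k in sequentially. \<tau> k + s \<in> ?S"
    using eq limit_arcD(2)[OF arc, of s] s by (auto elim: eventually_elim2)
  ultimately have "(\<lambda>k. v (\<tau> k + s)) \<longlonglongrightarrow> Inf (v ` ?S)"
    by (intro antimono_on_bounded_tendsto[OF v] filterlim_shift[OF \<tau>])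
  moreover have "(\<lambda>k. v (\<tau> k + s)) \<longlonglongrightarrow> V (y s, \<gamma>)"
  proof (rule Lim_transform_eventually)
    show "(\<lambda>k. V (x (\<tau> k + s), \<gamma>)) \<longlonglongrightarrow> V (y s, \<gamma>)"
      by (rule isCont_tendsto_compose[OF cont limit_arcD(3)[OF arc]])
        (use s in \<open>auto intro!: limit_arc_in_D[OF arc, simplified]\<close>)
    show "\<forall>\<^sub>F k in sequentially. V (x (\<tau> k + s), \<gamma>) = v (\<tau> k + s)"
      using eq by (rule eventually_mono) simp
  qed
  ultimately show ?thesis by (rule LIMSEQ_unique[rotated])
qed

text \<open>V need not be jointly continuous, so the limit of \<open>v\<close> need not be the value
  of V along \<open>y\<close>. Instead, a positive value of \<open>W\<close> at an interior time
  persists along late translates on a fixed window and makes \<open>v\<close> drop there by a fixed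
  amount, although \<open>v\<close> has the same limit at both ends.\<close>

lemma W_zero_if_continuous:
  assumes W: "continuous_on D (\<lambda>(\<xi>, \<gamma>). W \<gamma> \<xi>)" and v: "antimono_on {0..} v"
    and bdd: "bounded (V ` (domf \<inter> (B \<times> \<Gamma>)))"
    and \<tau>: "filterlim \<tau> at_top sequentially" and arc: "limit_arc \<tau> y a b \<gamma>" and s: "s \<in> {a..b}"
  shows "W \<gamma> (y s) = 0"
proof (rule limit_arc_const_closure[OF arc _ _ s])
  have "continuous_on {a..b} (\<lambda>s. case (y s, \<gamma>) of (\<xi>, \<gamma>) \<Rightarrow> W \<gamma> \<xi>)"
    by (rule continuous_on_compose2[OF W])
      (use limit_arc_continuous[OF arc] limit_arc_in_D[OF arc] in \<open>auto intro!: continuous_intros\<close>)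
  then show "continuous_on {a..b} (\<lambda>s. W \<gamma> (y s))" by simp
next
  fix s assume s: "s \<in> {a<..<b}"
  then have sD: "(y s, \<gamma>) \<in> D" by (intro limit_arc_in_D[OF arc]) auto
  show "W \<gamma> (y s) = 0"
  proof (rule ccontr)
    assume "W \<gamma> (y s) \<noteq> 0"
    then have "W \<gamma> (y s) > 0" using decreaseD(2)[OF sD] by simp
    define w where "w = W \<gamma> (y s) / 2"
    have w: "0 < w" using \<open>W \<gamma> (y s) > 0\<close> by (simp add: w_def)
    have "\<exists>r>0. \<forall>z\<in>D. dist z (y s, \<gamma>) < r \<longrightarrow> dist (case z of (\<xi>, \<gamma>) \<Rightarrow> W \<gamma> \<xi>) (W \<gamma> (y s)) < w"
      using W sD w unfolding continuous_on_iff by fastforce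
    then obtain r where "r > 0"
      and r: "\<And>z. z \<in> D \<Longrightarrow> dist z (y s, \<gamma>) < r \<Longrightarrow> dist (case z of (\<xi>, \<gamma>) \<Rightarrow> W \<gamma> \<xi>) (W \<gamma> (y s)) < w"
      by blast
    have r: "w \<le> W \<gamma>' \<xi>" if "(\<xi>, \<gamma>') \<in> D" "dist (\<xi>, \<gamma>') (y s, \<gamma>) < r" for \<xi> \<gamma>'
    proof -
      have "\<bar>W \<gamma>' \<xi> - W \<gamma> (y s)\<bar> < w" using r[OF that] by (simp add: dist_real_def)
      then have "- (W \<gamma>' \<xi> - W \<gamma> (y s)) < w" by (simp only: abs_less_iff)
      then show ?thesis unfolding w_def by (simp add: field_simps)
    qed
    have "s \<in> {a..b}" using s by auto
    then obtain \<eta> where "\<eta> > 0" and \<eta>: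
      "\<And>p q. a < p \<Longrightarrow> p < q \<Longrightarrow> q < b \<Longrightarrow> \<bar>p - s\<bar> < \<eta> \<Longrightarrow> \<bar>q - s\<bar> < \<eta> \<Longrightarrow>
        \<forall>\<^sub>F k in sequentially. 0 \<le> \<tau> k + a \<and> (\<forall>u\<in>{p..q}. \<sigma> (\<tau> k + u) = \<sigma> (\<tau> k + p) \<and>
           dist (x (\<tau> k + u), \<sigma> (\<tau> k + u)) (y s, \<gamma>) < r)"
      using limit_arc_near[OF arc _ \<open>r > 0\<close>] by blast
    obtain p where p: "max a (s - \<eta>) < p" "p < s" using dense[of "max a (s - \<eta>)" s] s \<open>\<eta> > 0\<close> by auto
    obtain q where q: "s < q" "q < min b (s + \<eta>)" using dense[of s "min b (s + \<eta>)"] s \<open>\<eta> > 0\<close> by auto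
    have "\<forall>\<^sub>F k in sequentially. 0 \<le> \<tau> k + a \<and> (\<forall>u\<in>{p..q}. \<sigma> (\<tau> k + u) = \<sigma> (\<tau> k + p) \<and>
           dist (x (\<tau> k + u), \<sigma> (\<tau> k + u)) (y s, \<gamma>) < r)"
      using p q by (intro \<eta>) auto
    then have "\<forall>\<^sub>F k in sequentially. v (\<tau> k + q) - v (\<tau> k + p) \<le> - ((q - p) * w)"
    proof (rule eventually_mono)
      fix k assume k: "0 \<le> \<tau> k + a \<and> (\<forall>u\<in>{p..q}. \<sigma> (\<tau> k + u) = \<sigma> (\<tau> k + p) \<and>
           dist (x (\<tau> k + u), \<sigma> (\<tau> k + u)) (y s, \<gamma>) < r)"
      let ?g = "\<sigma> (\<tau> k + p)"
      let ?I = "{\<tau> k + p..\<tau> k + q}"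
      have u: "0 \<le> u \<and> \<sigma> u = ?g \<and> dist (x u, \<sigma> u) (y s, \<gamma>) < r" if "u \<in> ?I" for u
      proof -
        have "u - \<tau> k \<in> {p..q}" using that by auto
        then have "\<sigma> (\<tau> k + (u - \<tau> k)) = ?g \<and> dist (x (\<tau> k + (u - \<tau> k)), \<sigma> (\<tau> k + (u - \<tau> k))) (y s, \<gamma>) < r"
          using k by blast
        moreover have "0 \<le> u" using that k p by auto
        ultimately show ?thesis by auto
      qed
      \<comment> \<open>The signal is constant on the window, so the trajectory itself is an arc
        there, with an index \<open>?g\<close> that may differ from \<gamma>. The mean value theorem
        is applied to V with this index, and joint continuity of \<open>W\<close> still gives the
        bound \<open>w\<close>.\<close>
      have self: "limit_arc (\<lambda>_. 0) x (\<tau> k + p) (\<tau> k + q) ?g"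
      proof (rule limit_arc_self)
        show "0 \<le> \<tau> k + p" "\<tau> k + p < \<tau> k + q" using k p q by auto
        show "\<sigma> u = ?g" if "u \<in> {\<tau> k + p<..<\<tau> k + q}" for u using u[of u] that by simp
      qed
      obtain u where u': "u \<in> {\<tau> k + p<..<\<tau> k + q}" and
        mvt: "V (x (\<tau> k + q), ?g) - V (x (\<tau> k + p), ?g)
          = (\<tau> k + q - (\<tau> k + p)) *\<^sub>R (grad (\<lambda>\<zeta>. V (\<zeta>, ?g)) (x u) \<bullet> f (x u, ?g))"
        using mvt_simple[of "\<tau> k + p" "\<tau> k + q" "\<lambda>u. V (x u, ?g)"
            "\<lambda>u h. h *\<^sub>R (grad (\<lambda>\<zeta>. V (\<zeta>, ?g)) (x u) \<bullet> f (x u, ?g))"]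
          limit_arc_V_derivative[OF self] p q by (auto simp: has_vector_derivative_def)
      then have uI: "u \<in> ?I" by auto
      have "w \<le> W ?g (x u)"
        using r[OF x_\<sigma>_in_D[of u]] u[OF uI] by auto
      also have "\<dots> \<le> - (grad (\<lambda>\<zeta>. V (\<zeta>, ?g)) (x u) \<bullet> f (x u, ?g))"
        using decreaseD(1)[OF x_\<sigma>_in_D[of u]] u[OF uI] by simp
      finally have "(q - p) * w \<le> (q - p) * - (grad (\<lambda>\<zeta>. V (\<zeta>, ?g)) (x u) \<bullet> f (x u, ?g))"
        using p q by (intro mult_left_mono) auto
      moreover have "\<sigma> (\<tau> k + q) = ?g" using u[of "\<tau> k + q"] p q by simp
      ultimately show "v (\<tau> k + q) - v (\<tau> k + p) \<le> - ((q - p) * w)"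
        using mvt by simp
    qed
    moreover have "(\<lambda>k. v (\<tau> k + q) - v (\<tau> k + p)) \<longlonglongrightarrow> Inf (v ` {0..}) - Inf (v ` {0..})"
      by (intro tendsto_diff v_tendsto[OF v bdd] filterlim_shift[OF \<tau>])
    ultimately have "Inf (v ` {0..}) - Inf (v ` {0..}) \<le> - ((q - p) * w)"
      by (intro tendsto_upperbound) auto
    moreover have "0 < (q - p) * w" using p q w by simp
    ultimately show False by simp
  qed
qed

end

section \<open>Convergence to zero under the three sets of hypotheses\<close>

theorem theorem4p3:
  fixes \<Gamma> :: "'g::metric_space set"
    and domf :: "((real^'n) \<times> 'g) set"
    and f :: "(real^'n) \<times> 'g \<Rightarrow> real^'n"
    and x :: "real \<Rightarrow> real^'n"
    and \<sigma> :: "real \<Rightarrow> 'g"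
    and J :: "real set"
  assumes "compact \<Gamma>"
    and "domf \<subseteq> UNIV \<times> \<Gamma>" and "closed domf" and "continuous_on domf f"
    and "\<And>\<gamma>. \<gamma> \<in> \<Gamma> \<Longrightarrow> 0 \<in> fiber domf \<gamma> \<Longrightarrow> f (0, \<gamma>) = 0"
    and "\<And>\<gamma>. \<gamma> \<in> \<Gamma> \<Longrightarrow> 0 \<in> fiber domf \<gamma> \<Longrightarrow>
           unique_zero_solution (fiber domf \<gamma>) (\<lambda>\<xi>. f (\<xi>, \<gamma>))"
    and "trajectory \<Gamma> domf f J x \<sigma>" and "{0..} \<subseteq> J"
    and "\<sigma> \<in> avg_dwell_signals \<Gamma>"
  shows
    "((\<exists>domV V W.
         class_V \<Gamma> domf domV V \<and>
         (\<forall>K. compact K \<and> K \<subseteq> domf \<inter> (fst ` domV \<times> \<Gamma>) \<longrightarrow> bounded (V ` K)) \<and>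
         precompact_rel (fst ` domV) J x \<and>
         antimono_on {0..} (\<lambda>t. V (x t, \<sigma> t)) \<and>
         decrease_cond \<Gamma> domf f domV V W \<and>
         continuous_on (domf \<inter> (fst ` domV \<times> \<Gamma>)) (\<lambda>(\<xi>, \<gamma>). W \<gamma> \<xi>) \<and>
         0 \<in> fst ` domV \<and>
         cond_i \<Gamma> domf f domV W \<and> cond_ii \<Gamma> domf f domV W)
       \<longrightarrow> (x \<longlongrightarrow> 0) at_top)
     \<and>
     (finite \<Gamma> \<and>
      (\<exists>domV V W.
         class_V \<Gamma> domf domV V \<and>
         precompact_rel (fst ` domV) J x \<and>
         (\<forall>\<gamma>\<in>\<Gamma>. antimono_on (\<sigma> -` {\<gamma>} \<inter> {0..}) (\<lambda>t. V (x t, \<sigma> t))) \<and>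
         decrease_cond \<Gamma> domf f domV V W \<and>
         0 \<in> fst ` domV \<and>
         cond_i \<Gamma> domf f domV W \<and> cond_ii \<Gamma> domf f domV W)
       \<longrightarrow> (x \<longlongrightarrow> 0) at_top)
     \<and>
     ((\<exists>domV V W.
         class_V \<Gamma> domf domV V \<and>
         continuous_on (domf \<inter> (fst ` domV \<times> \<Gamma>)) V \<and>
         precompact_rel (fst ` domV) J x \<and>
         antimono_on {0..} (\<lambda>t. V (x t, \<sigma> t)) \<and>
         decrease_cond \<Gamma> domf f domV V W \<and>
         0 \<in> fst ` domV \<and>
         cond_i \<Gamma> domf f domV W \<and> cond_ii' \<Gamma> domf f domV V W)
       \<longrightarrow> (x \<longlongrightarrow> 0) at_top)"
proof -
  have lyap: "\<exists>B. lyapunov_trajectory \<Gamma> domf f x \<sigma> J B domV V W"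
    if V: "class_V \<Gamma> domf domV V" "precompact_rel (fst ` domV) J x" "decrease_cond \<Gamma> domf f domV V W"
    for domV V W
  proof -
    obtain B where "compact B" "B \<subseteq> fst ` domV" "\<And>t. t \<in> J \<Longrightarrow> x t \<in> B"
      using V(2) unfolding precompact_rel_def by blast
    then have "lyapunov_trajectory \<Gamma> domf f x \<sigma> J B domV V W"
      using assms(1,3,4,7,8) V by unfold_locales
    then show ?thesis by blast
  qed
  show ?thesis
  proof (intro conjI impI; elim exE conjE)
    fix domV :: "((real^'n) \<times> 'g) set" and V W
    assume V: "class_V \<Gamma> domf domV V" "precompact_rel (fst ` domV) J x" "decrease_cond \<Gamma> domf f domV V W"
      and bdd: "\<forall>K. compact K \<and> K \<subseteq> domf \<inter> (fst ` domV \<times> \<Gamma>) \<longrightarrow> bounded (V ` K)"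
      and anti: "antimono_on {0..} (\<lambda>t. V (x t, \<sigma> t))"
      and W: "continuous_on (domf \<inter> (fst ` domV \<times> \<Gamma>)) (\<lambda>(\<xi>, \<gamma>). W \<gamma> \<xi>)"
      and c: "cond_i \<Gamma> domf f domV W" "cond_ii \<Gamma> domf f domV W"
    obtain B where "lyapunov_trajectory \<Gamma> domf f x \<sigma> J B domV V W" using lyap[OF V] by blast
    then interpret lyapunov_trajectory \<Gamma> domf f x \<sigma> J B domV V W .
    have b: "bounded (V ` (domf \<inter> (B \<times> \<Gamma>)))" using bdd compact_domf_B domf_B_subset_D by blast
    show "(x \<longlongrightarrow> 0) at_top"
    proof (rule tendsto_zero_if_limit_arcs_vanish[OF assms(9) B_subset assms(6), where W = W and Q = "\<lambda>_ _. True"])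
      show "W \<gamma> (y s) = 0 \<and> True" if "filterlim \<tau> at_top sequentially" "limit_arc \<tau> y a b \<gamma>" "s \<in> {a..b}"
        for \<tau> y a b \<gamma> s using W_zero_if_continuous[OF W anti b that] by simp
    qed (use c[unfolded cond_i_def cond_ii_def sect_def] in blast)+
  next
    fix domV :: "((real^'n) \<times> 'g) set" and V W
    assume fin: "finite \<Gamma>" and V: "class_V \<Gamma> domf domV V" "precompact_rel (fst ` domV) J x" "decrease_cond \<Gamma> domf f domV V W"
      and anti: "\<forall>\<gamma>\<in>\<Gamma>. antimono_on (\<sigma> -` {\<gamma>} \<inter> {0..}) (\<lambda>t. V (x t, \<sigma> t))"
      and c: "cond_i \<Gamma> domf f domV W" "cond_ii \<Gamma> domf f domV W"
    obtain B where "lyapunov_trajectory \<Gamma> domf f x \<sigma> J B domV V W" using lyap[OF V] by blast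
    then interpret lyapunov_trajectory \<Gamma> domf f x \<sigma> J B domV V W .
    show "(x \<longlongrightarrow> 0) at_top"
    proof (rule tendsto_zero_if_limit_arcs_vanish[OF assms(9) B_subset assms(6), where W = W and Q = "\<lambda>_ _. True"])
      show "W \<gamma> (y s) = 0 \<and> True" if "filterlim \<tau> at_top sequentially" "limit_arc \<tau> y a b \<gamma>" "s \<in> {a..b}"
        for \<tau> y a b \<gamma> s
        using W_zero_if_V_constant[OF that(2) V_constant_if_finite[OF fin _ that(1,2)] that(3)]
          anti limit_arcD(6)[OF that(2)] by blast
    qed (use c[unfolded cond_i_def cond_ii_def sect_def] in blast)+
  next
    fix domV :: "((real^'n) \<times> 'g) set" and V W
    assume V: "class_V \<Gamma> domf domV V" "precompact_rel (fst ` domV) J x" "decrease_cond \<Gamma> domf f domV V W"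
      and cont: "continuous_on (domf \<inter> (fst ` domV \<times> \<Gamma>)) V"
      and anti: "antimono_on {0..} (\<lambda>t. V (x t, \<sigma> t))"
      and c: "cond_i \<Gamma> domf f domV W" "cond_ii' \<Gamma> domf f domV V W"
    obtain B where "lyapunov_trajectory \<Gamma> domf f x \<sigma> J B domV V W" using lyap[OF V] by blast
    then interpret lyapunov_trajectory \<Gamma> domf f x \<sigma> J B domV V W .
    have sect_fiber: "sect domf domV \<gamma> \<subseteq> fiber domV \<gamma>" if "\<gamma> \<in> \<Gamma>" for \<gamma>
      using V(1) that by (simp add: class_V_def)
    \<comment> \<open>The constant \<open>c\<close> of (ii') is the infimum of \<open>v\<close>, the
      same for both arcs at a junction. \<open>Q\<close> also records membership in the section of
      \<open>domV\<close>, since the level sets in (ii') are taken inside it.\<close>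
    show "(x \<longlongrightarrow> 0) at_top"
    proof (rule tendsto_zero_if_limit_arcs_vanish[OF assms(9) B_subset assms(6), where W = W and
          Q = "\<lambda>\<gamma> \<xi>. \<xi> \<in> fiber domV \<gamma> \<and> V (\<xi>, \<gamma>) = Inf (v ` {0..})"])
      show "W \<gamma> (y s) = 0 \<and> y s \<in> fiber domV \<gamma> \<and> V (y s, \<gamma>) = Inf (v ` {0..})"
        if "filterlim \<tau> at_top sequentially" "limit_arc \<tau> y a b \<gamma>" "s \<in> {a..b}" for \<tau> y a b \<gamma> s
      proof -
        have "y s \<in> fiber domV \<gamma>"
          using limit_arc_in_D[OF that(2,3)] sect_fiber by (auto simp: sect_def fiber_def)
        then show ?thesis
          using W_zero_if_V_constant[OF that(2) V_constant_if_continuous[OF cont anti that(1,2)] that(3)] by blast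
      qed
    next
      fix \<gamma> \<gamma>' \<xi>
      assume "\<gamma> \<in> \<Gamma>" "\<gamma>' \<in> \<Gamma>" "\<gamma> \<noteq> \<gamma>'"
        "\<xi> \<in> bwd (fst ` domV \<inter> fiber domf \<gamma>) (\<lambda>\<xi>. f (\<xi>, \<gamma>)) (W \<gamma>)"
        "\<xi> \<in> fwd (fst ` domV \<inter> fiber domf \<gamma>') (\<lambda>\<xi>. f (\<xi>, \<gamma>')) (W \<gamma>')"
        "\<xi> \<in> fiber domV \<gamma> \<and> V (\<xi>, \<gamma>) = Inf (v ` {0..})"
        "\<xi> \<in> fiber domV \<gamma>' \<and> V (\<xi>, \<gamma>') = Inf (v ` {0..})"
      then show "\<xi> = 0" using c(2) unfolding cond_ii'_def sect_def by blast
    qed (use c in \<open>auto simp: cond_i_def sect_def\<close>)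
  qed
qed

end
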